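(* Fix $0<p<1$ and let $b=1/(1-p)$. If $t=t(n)$ is a positive integer with $t(n)\le \log\log_b n$, then asymptotically almost surely \[ \alpha_t(G(n,p))=2\log_b n+t-2\log_b t-\frac{2\log_b\log_b (np)}{t}+\Theta(1). \]
   Context: $G(n,p)$ is the Erdős–Rényi random graph on $[n]$ with independent edge probability $p$. Logarithms without a base are natural. For a positive integer $t$, a $t$-component set of a graph $G$ is a vertex subset inducing a subgraph whose connected components all have at most $t$ vertices; $\alpha_t(G)$ is the maximum size of a $t$-component set of $G$. Here $\Theta(1)$ denotes a term bounded in absolute value by a constant independent of $n$. A property holds asymptotically almost surely (a.a.s.) if its probability tends to $1$ as $n\to\infty$. *)

theory Defs
  imports "HOL-Probability.Probability"
begin

text \<open>
  A simple graph is given by a vertex set \<open>V\<close> and a set \<open>E\<close> of edges, each edge being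
  a two-element subset of \<open>V\<close>.
\<close>

definition complete_edges :: "'a set \<Rightarrow> 'a set set" where
  "complete_edges V = {e. e \<subseteq> V \<and> card e = 2}"

definition induced_edges :: "'a set set \<Rightarrow> 'a set \<Rightarrow> 'a set set" where
  "induced_edges E S = {e \<in> E. e \<subseteq> S}"

definition reachable_rel :: "'a set \<Rightarrow> 'a set set \<Rightarrow> ('a \<times> 'a) set" where
  "reachable_rel V E = {(u, v). u \<in> V \<and> v \<in> V \<and> (u, v) \<in> {(x, y). {x, y} \<in> E}\<^sup>*}"

definition connected_components :: "'a set \<Rightarrow> 'a set set \<Rightarrow> 'a set set" where
  "connected_components V E = V // reachable_rel V E"

definition t_component_set :: "nat \<Rightarrow> 'a set \<Rightarrow> 'a set set \<Rightarrow> 'a set \<Rightarrow> bool" where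
  "t_component_set t V E S \<longleftrightarrow>
     S \<subseteq> V \<and> (\<forall>C \<in> connected_components S (induced_edges E S). card C \<le> t)"

text \<open>Only meaningful for finite \<open>V\<close>; the empty set is always a \<open>t\<close>-component set, so the
  maximum is then over a finite nonempty set.\<close>

definition alpha_t :: "nat \<Rightarrow> 'a set \<Rightarrow> 'a set set \<Rightarrow> nat" where
  "alpha_t t V E = Max (card ` {S. t_component_set t V E S})"

text \<open>The random graph \<open>G(n,p)\<close> on \<open>{1..n}\<close>, as a distribution on edge sets.\<close>

definition Gnp :: "nat \<Rightarrow> real \<Rightarrow> nat set set pmf" where
  "Gnp n p =
     map_pmf (\<lambda>f. {e \<in> complete_edges {1..n}. f e})
       (Pi_pmf (complete_edges {1..n}) False (\<lambda>_. bernoulli_pmf p))"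

end

theory Submission
  imports Defs "HOL-Real_Asymp.Real_Asymp"
begin

text \<open>
  Upper bound: splitting off the component of a vertex shows by induction that a \<open>k\<close>-set is a
  \<open>t\<close>-component set with probability at most \<open>(K z) ^ k * (1 - p) ^ (k choose 2)\<close>, where
  \<open>k \<le> K\<close> and \<open>z\<close> is a weight of order \<open>b powr ((t - 1) / 2) / (t * K powr (1 / t))\<close>; a union bound
  over the \<open>K\<close>-sets finishes the proof.

  Lower bound: the second moment method is applied to the injections of \<open>{..<k}\<close> into the vertex
  set that map the residue classes modulo \<open>m\<close>, for \<open>m\<close> the least integer not below \<open>k / t\<close>, to
  pairwise nonadjacent blocks, each spanned by a star. Requiring the stars to be present is what
  makes the second moment work: they nearly determine the blocks, so that one
  \<open>t\<close>-component set is counted only about \<open>k powr (k / t) * t ^ k\<close> times.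
\<close>

subsection \<open>Edge sets of the random graph\<close>

text \<open>The formula is a balance per vertex. Up to a constant factor per vertex, the number of
  \<open>k\<close>-sets in \<open>n\<close> vertices together with a partition into parts of size
  \<open>t\<close> has \<open>k\<close>-th root \<open>n / (t * k powr (1 / t))\<close>, and the
  roughly \<open>k * (k - t) / 2\<close> pairs between parts have to be non-edges, which costs
  \<open>b powr ((k - t) / 2)\<close> per vertex. Solving for \<open>k\<close> gives the four terms
  of the estimate. A further constant factor per vertex moves \<open>k\<close> by O(1) only, so
  constants such as 4, 16 and \<open>1 / p\<close> may be crude.

  The obstacle is the lower bound for pairs of embeddings with nearly the same vertices. Without
  stars, the pair bound used here would be summed over all \<open>k!\<close> orders of these
  vertices, which puts \<open>k\<close> in place of \<open>t * k powr (1 / t)\<close>; for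
  \<open>t >= 2\<close> the resulting loss is unbounded. The stars themselves cost one factor
  \<open>p\<close> per leaf, again only O(1).\<close>

lemma finite_complete_edges: "finite V \<Longrightarrow> finite (complete_edges V)"
  unfolding complete_edges_def by (rule finite_subset[of _ "Pow V"]) auto

lemma complete_edges_mono: "A \<subseteq> B \<Longrightarrow> complete_edges A \<subseteq> complete_edges B"
  unfolding complete_edges_def by auto

lemma prob_Gnp_present_absent:
  assumes p: "0 < p" "p < 1"
    and A: "A \<subseteq> complete_edges {1..n}" and B: "B \<subseteq> complete_edges {1..n}" and AB: "A \<inter> B = {}"
  shows "measure_pmf.prob (Gnp n p) {E. A \<subseteq> E \<and> B \<inter> E = {}} = p ^ card A * (1 - p) ^ card B"
proof -
  let ?U = "complete_edges {1..n}"
  let ?F = "\<lambda>e. if e \<in> A then {True} else if e \<in> B then {False} else UNIV"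
  have fin: "finite ?U" by (simp add: finite_complete_edges)
  have "(\<lambda>f. {e \<in> ?U. f e}) -` {E. A \<subseteq> E \<and> B \<inter> E = {}} = Pi ?U ?F"
    using A B AB by (auto simp: Pi_def split: if_splits)
  then have "measure_pmf.prob (Gnp n p) {E. A \<subseteq> E \<and> B \<inter> E = {}}
      = measure_pmf.prob (Pi_pmf ?U False (\<lambda>_. bernoulli_pmf p)) (Pi ?U ?F)"
    by (simp add: Gnp_def)
  also have "\<dots> = (\<Prod>e\<in>?U. measure_pmf.prob (bernoulli_pmf p) (?F e))"
    by (rule measure_Pi_pmf_Pi[OF fin])
  also have "\<dots> = (\<Prod>e\<in>?U. (if e \<in> A then p else 1) * (if e \<in> B then 1 - p else 1))"
    using p AB by (intro prod.cong refl) (auto simp: measure_pmf_single)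
  also have "\<dots> = p ^ card A * (1 - p) ^ card B"
  proof -
    have "(\<Prod>e\<in>?U. if e \<in> X then q else 1) = q ^ card X" if "X \<subseteq> ?U" for X and q :: real
      using that by (simp only: prod.inter_restrict[OF fin, symmetric]) (simp add: Int_absorb1)
    with A B show ?thesis by (simp only: prod.distrib)
  qed
  finally show ?thesis .
qed

lemma prob_Gnp_absent:
  assumes "0 < p" "p < 1" "B \<subseteq> complete_edges {1..n}"
  shows "measure_pmf.prob (Gnp n p) {E. B \<inter> E = {}} = (1 - p) ^ card B"
  using prob_Gnp_present_absent[of p "{}" n B] assms by simp

subsection \<open>Components\<close>

lemma rtrancl_induced_edges_mono:
  assumes "S' \<subseteq> S"
  shows "{(x, y). {x, y} \<in> induced_edges E S'}\<^sup>* \<subseteq> {(x, y). {x, y} \<in> induced_edges E S}\<^sup>*"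
  using assms by (intro rtrancl_mono) (auto simp: induced_edges_def)

lemma t_component_set_subset:
  assumes S: "t_component_set t V E S" and "S' \<subseteq> S" "finite S"
  shows "t_component_set t V E S'"
proof -
  have "card C \<le> t" if "C \<in> connected_components S' (induced_edges E S')" for C
  proof -
    from that obtain v where v: "v \<in> S'" and C: "C = reachable_rel S' (induced_edges E S') `` {v}"
      unfolding connected_components_def by (auto elim: quotientE)
    let ?D = "reachable_rel S (induced_edges E S) `` {v}"
    have "?D \<in> connected_components S (induced_edges E S)"
      using v assms unfolding connected_components_def by (auto intro: quotientI)
    then have "card ?D \<le> t" using S by (auto simp: t_component_set_def)
    moreover have "C \<subseteq> ?D"
      using rtrancl_induced_edges_mono[OF assms(2), of E] assms(2)
      by (auto simp: C reachable_rel_def)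
    moreover have "finite ?D"
      by (rule finite_subset[OF _ assms(3)]) (auto simp: reachable_rel_def)
    ultimately show ?thesis using card_mono[of ?D C] by linarith
  qed
  then show ?thesis using assms by (auto simp: t_component_set_def)
qed

text \<open>Connectivity of \<open>C\<close> is dropped: a union bound over all candidates
  \<open>C\<close> needs only that no edge leaves \<open>C\<close> inside \<open>S\<close>.\<close>

lemma t_component_set_component:
  assumes S: "t_component_set t V E S" and v: "v \<in> S"
  obtains C where "v \<in> C" "C \<subseteq> S" "card C \<le> t" "\<And>x y. x \<in> C \<Longrightarrow> y \<in> S - C \<Longrightarrow> {x, y} \<notin> E"
proof -
  let ?r = "{(x, y). {x, y} \<in> induced_edges E S}"
  let ?C = "reachable_rel S (induced_edges E S) `` {v}"
  have "card ?C \<le> t"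
    using S v by (auto simp: t_component_set_def connected_components_def intro: quotientI)
  moreover have "{x, y} \<notin> E" if "x \<in> ?C" "y \<in> S - ?C" for x y
  proof
    assume "{x, y} \<in> E"
    then have "(x, y) \<in> ?r" using that by (auto simp: induced_edges_def reachable_rel_def)
    with that show False
      by (auto simp: reachable_rel_def intro: rtrancl_into_rtrancl)
  qed
  ultimately show ?thesis using v by (intro that[of ?C]) (auto simp: reachable_rel_def)
qed

text \<open>A labelling \<open>f\<close> that never changes along an edge is constant on components,
  so every component lies in a fibre of \<open>f\<close>.\<close>

lemma t_component_set_blocks:
  assumes S: "S \<subseteq> V" "finite S" and f: "\<And>x y. x \<in> S \<Longrightarrow> y \<in> S \<Longrightarrow> f x \<noteq> f y \<Longrightarrow> {x, y} \<notin> E"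
    and card: "\<And>c. card {x \<in> S. f x = c} \<le> t"
  shows "t_component_set t V E S"
proof -
  have step: "f x = f y \<and> y \<in> S"
    if "(x, y) \<in> {(x, y). {x, y} \<in> induced_edges E S}\<^sup>*" "x \<in> S" for x y
    using that
  proof (induction rule: rtrancl_induct)
    case (step y z)
    then have "f x = f y" "y \<in> S" "z \<in> S" "{y, z} \<in> E" by (auto simp: induced_edges_def)
    with f[of y z] show ?case by auto
  qed simp
  have "card C \<le> t" if "C \<in> connected_components S (induced_edges E S)" for C
  proof -
    from that obtain v where v: "v \<in> S" and C: "C = reachable_rel S (induced_edges E S) `` {v}"
      unfolding connected_components_def by (auto elim: quotientE)
    have "C \<subseteq> {x \<in> S. f x = f v}" using step v by (auto simp: C reachable_rel_def)
    then show ?thesis using card_mono[of "{x \<in> S. f x = f v}" C] card[of "f v"] S by simp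
  qed
  with S show ?thesis by (auto simp: t_component_set_def)
qed

text \<open>Heredity allows sets of size exactly \<open>k\<close>, so that the upper tail is a union
  over the \<open>k\<close>-subsets alone.\<close>

lemma alpha_t_ge_iff:
  assumes "finite V"
  shows "k \<le> alpha_t t V E \<longleftrightarrow> (\<exists>S. t_component_set t V E S \<and> card S = k)"
proof
  let ?F = "{S. t_component_set t V E S}"
  have fin: "finite ?F"
    by (rule finite_subset[of _ "Pow V"]) (use assms in \<open>auto simp: t_component_set_def\<close>)
  have "{} \<in> ?F" by (simp add: t_component_set_def connected_components_def)
  then have ne: "card ` ?F \<noteq> {}" by blast
  {
    assume k: "k \<le> alpha_t t V E"
    have "alpha_t t V E \<in> card ` ?F"
      unfolding alpha_t_def using fin ne by (intro Max_in) auto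
    then obtain S where S: "t_component_set t V E S" "card S = alpha_t t V E" by auto
    with k obtain S' where "S' \<subseteq> S" "card S' = k" by (metis obtain_subset_with_card_n)
    moreover have "finite S" using S assms by (auto simp: t_component_set_def intro: finite_subset)
    ultimately show "\<exists>S. t_component_set t V E S \<and> card S = k"
      using t_component_set_subset[OF S(1)] by blast
  }
  assume "\<exists>S. t_component_set t V E S \<and> card S = k"
  then show "k \<le> alpha_t t V E" unfolding alpha_t_def using fin by (auto intro!: Max_ge)
qed

subsection \<open>The first moment\<close>

lemma choose_two_real: "real (k choose 2) = real k * (real k - 1) / 2"
proof (cases k)
  case (Suc m)
  have "2 * (k choose 2) = k * (k - 1)"
    using choose_two[of k] by (simp add: Suc)
  then have "2 * real (k choose 2) = real k * real (k - 1)" by (metis of_nat_mult of_nat_numeral)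
  then show ?thesis by (simp add: Suc)
qed simp

lemma choose_two_split:
  assumes "s \<le> k"
  shows "k choose 2 = (k - s choose 2) + s * (k - s) + (s choose 2)"
proof -
  have "real (k choose 2) = real ((k - s choose 2) + s * (k - s) + (s choose 2))"
    using assms by (simp add: choose_two_real of_nat_diff field_simps)
  then show ?thesis by (simp only: of_nat_eq_iff)
qed

text \<open>A single term of the exponential series; it takes the place of Stirling's
  formula.\<close>

lemma power_le_exp_fact: "real x ^ s \<le> exp (real x) * fact s"
proof -
  have "real x ^ s /\<^sub>R fact s \<le> exp (real x)"
    unfolding exp_def
    by (rule order_trans[OF _ sum_le_suminf[of _ "{s}"]])
      (auto simp: summable_exp intro!: mult_nonneg_nonneg)
  then show ?thesis by (simp add: field_simps scaleR_conv_of_real)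
qed

lemma card_subsets_containing:
  assumes "finite S" "v \<in> S" "1 \<le> s"
  shows "card {C. v \<in> C \<and> C \<subseteq> S \<and> card C = s} = (card S - 1) choose (s - 1)"
proof -
  have "bij_betw (insert v) {D. D \<subseteq> S - {v} \<and> card D = s - 1} {C. v \<in> C \<and> C \<subseteq> S \<and> card C = s}"
  proof (rule bij_betwI[where g = "\<lambda>C. C - {v}"])
    show "insert v \<in> {D. D \<subseteq> S - {v} \<and> card D = s - 1} \<rightarrow> {C. v \<in> C \<and> C \<subseteq> S \<and> card C = s}"
    proof safe
      fix D assume D: "D \<subseteq> S - {v}" "card D = s - 1"
      then have "finite D" using assms finite_subset by blast
      moreover have "v \<notin> D" using D by auto
      ultimately show "card (insert v D) = s" using assms D by simp
    qed (use assms in auto)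
  qed (use assms in auto)
  from bij_betw_same_card[OF this] show ?thesis
    using n_subsets[of "S - {v}" "s - 1"] assms by simp
qed

text \<open>The set \<open>H\<close> makes the induction work: it collects the pairs between
  components already split off and everything after them, all required to be non-edges. These pairs
  are disjoint from those inside the remaining set, and independence is invoked just once, when no
  vertex is left. Sizes are compared with a fixed \<open>K\<close>, so that the same inequality
  \<open>weights\<close> serves every step; its terms are the relative costs of splitting off a
  component of size \<open>s\<close>.\<close>

lemma prob_t_component_set_le:
  fixes p b z :: real
  assumes p: "0 < p" "p < 1" and b: "b = 1 / (1 - p)" and z: "0 < z" and K: "0 < K"
    and weights: "(\<Sum>s = 1..t. b ^ (s choose 2) / (z ^ s * fact (s - 1))) \<le> real K"
    and "S \<subseteq> {1..n}" "card S = k" "k \<le> K"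
    and "H \<subseteq> complete_edges {1..n}" "H \<inter> complete_edges S = {}"
  shows "measure_pmf.prob (Gnp n p) {E. H \<inter> E = {} \<and> t_component_set t {1..n} E S}
    \<le> (1 - p) ^ card H * ((real K * z) ^ k * (1 - p) ^ (k choose 2))"
  using assms(7-)
proof (induction k arbitrary: S H rule: less_induct)
  case (less k S H)
  let ?P = "measure_pmf.prob (Gnp n p)"
  have finS: "finite S" using less.prems finite_subset by blast
  have finH: "finite H" using less.prems(4) finite_complete_edges[of "{1..n}"] finite_subset by blast
  show ?case
  proof (cases "k = 0")
    case True
    have "?P {E. H \<inter> E = {} \<and> t_component_set t {1..n} E S} \<le> ?P {E. H \<inter> E = {}}"
      by (rule measure_pmf.finite_measure_mono) auto
    also have "\<dots> = (1 - p) ^ card H" by (rule prob_Gnp_absent[OF p less.prems(4)])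
    finally show ?thesis using True by (simp add: binomial_eq_0)
  next
    case False
    \<comment> \<open>Splitting off the component of a fixed vertex leaves only \<open>s - 1\<close>
      further vertices to choose. This gains the factor \<open>1 / K\<close> that offsets the bound
      \<open>K\<close> in \<open>weights\<close>.\<close>
    then obtain v where v: "v \<in> S" using less.prems(2) by fastforce
    define X where "X C = (\<lambda>(x, y). {x, y}) ` (C \<times> (S - C))" for C :: "nat set"
    define F where "F = {C. v \<in> C \<and> C \<subseteq> S \<and> card C \<le> t}"
    define g where "g s = (1 - p) ^ (card H + s * (k - s)) *
      ((real K * z) ^ (k - s) * (1 - p) ^ (k - s choose 2))" for s
    define M where "M = (1 - p) ^ card H * ((real K * z) ^ k * (1 - p) ^ (k choose 2))"
    have M: "M \<ge> 0" unfolding M_def using p z by simp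
    have F1: "card C \<ge> 1" "card C \<le> k" if "C \<in> F" for C
    proof -
      have C: "v \<in> C" "C \<subseteq> S" using that by (auto simp: F_def)
      then have "finite C" using finS finite_subset by blast
      with C(1) have "card C \<noteq> 0" by auto
      then show "card C \<ge> 1" by simp
      show "card C \<le> k" using card_mono[OF finS C(2)] less.prems(2) by simp
    qed
    have finF: "finite F" unfolding F_def using finS by simp
    have "{E. H \<inter> E = {} \<and> t_component_set t {1..n} E S}
        \<subseteq> (\<Union>C\<in>F. {E. (H \<union> X C) \<inter> E = {} \<and> t_component_set t {1..n} E (S - C)})"
    proof
      fix E assume "E \<in> {E. H \<inter> E = {} \<and> t_component_set t {1..n} E S}"
      then have HE: "H \<inter> E = {}" and S: "t_component_set t {1..n} E S" by auto
      from t_component_set_component[OF S v] obtain C where C: "v \<in> C" "C \<subseteq> S" "card C \<le> t"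
        "\<And>x y. x \<in> C \<Longrightarrow> y \<in> S - C \<Longrightarrow> {x, y} \<notin> E" by metis
      have "C \<in> F" using C by (simp add: F_def)
      moreover have "(H \<union> X C) \<inter> E = {}" using HE C(4) by (auto simp: X_def)
      moreover have "t_component_set t {1..n} E (S - C)"
        using t_component_set_subset[OF S _ finS] by blast
      ultimately show "E \<in> (\<Union>C\<in>F. {E. (H \<union> X C) \<inter> E = {} \<and> t_component_set t {1..n} E (S - C)})"
        by blast
    qed
    then have "?P {E. H \<inter> E = {} \<and> t_component_set t {1..n} E S}
        \<le> ?P (\<Union>C\<in>F. {E. (H \<union> X C) \<inter> E = {} \<and> t_component_set t {1..n} E (S - C)})"
      by (intro measure_pmf.finite_measure_mono) auto
    also have "\<dots> \<le> (\<Sum>C\<in>F. ?P {E. (H \<union> X C) \<inter> E = {} \<and> t_component_set t {1..n} E (S - C)})"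
      by (rule measure_pmf.finite_measure_subadditive_finite[OF finF]) auto
    also have "\<dots> \<le> (\<Sum>C\<in>F. g (card C))"
    proof (rule sum_mono)
      fix C assume CF: "C \<in> F"
      then have CS: "v \<in> C" "C \<subseteq> S" by (auto simp: F_def)
      have finC: "finite C" using CS finS finite_subset by blast
      have cD: "card (S - C) = k - card C" using CS finC less.prems(2) by (simp add: card_Diff_subset)
      have inj: "inj_on (\<lambda>(x, y). {x, y}) (C \<times> (S - C))"
        by (auto simp: inj_on_def doubleton_eq_iff)
      have cX: "card (X C) = card C * (k - card C)"
        unfolding X_def card_image[OF inj] card_cartesian_product cD ..
      have XS: "X C \<subseteq> complete_edges S"
        using CS unfolding X_def complete_edges_def by (auto simp: card_insert_if)
      have XD: "X C \<inter> complete_edges (S - C) = {}"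
        unfolding X_def complete_edges_def by auto
      have XV: "X C \<subseteq> complete_edges {1..n}"
        using XS complete_edges_mono[OF less.prems(1)] by blast
      have HX: "H \<inter> X C = {}" using XS less.prems(5) by blast
      have cHX: "card (H \<union> X C) = card H + card C * (k - card C)"
        using card_Un_disjoint[OF finH _ HX] finC finS cX by (simp add: X_def)
      have "?P {E. (H \<union> X C) \<inter> E = {} \<and> t_component_set t {1..n} E (S - C)}
        \<le> (1 - p) ^ card (H \<union> X C) * ((real K * z) ^ (k - card C) * (1 - p) ^ (k - card C choose 2))"
      proof (rule less.IH)
        show "k - card C < k" using F1[OF CF] by simp
        show "S - C \<subseteq> {1..n}" using less.prems(1) by blast
        show "card (S - C) = k - card C" by (rule cD)
        show "k - card C \<le> K" using less.prems(3) by simp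
        show "H \<union> X C \<subseteq> complete_edges {1..n}" using less.prems(4) XV by blast
        show "(H \<union> X C) \<inter> complete_edges (S - C) = {}"
          using XD less.prems(5) complete_edges_mono[of "S - C" S] by blast
      qed
      then show "?P {E. (H \<union> X C) \<inter> E = {} \<and> t_component_set t {1..n} E (S - C)} \<le> g (card C)"
        by (simp add: g_def cHX)
    qed
    also have "\<dots> = (\<Sum>s = 1..t. \<Sum>C | C \<in> F \<and> card C = s. g (card C))"
      by (rule sum.group[symmetric]) (use finF F1 in \<open>auto simp: F_def\<close>)
    also have "\<dots> = (\<Sum>s = 1..t. real ((k - 1) choose (s - 1)) * g s)"
    proof (rule sum.cong[OF refl])
      fix s assume s: "s \<in> {1..t}"
      then have "{C. C \<in> F \<and> card C = s} = {C. v \<in> C \<and> C \<subseteq> S \<and> card C = s}"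
        by (auto simp: F_def)
      then have "card {C. C \<in> F \<and> card C = s} = (k - 1) choose (s - 1)"
        using card_subsets_containing[OF finS v, of s] s less.prems(2) by simp
      then show "(\<Sum>C | C \<in> F \<and> card C = s. g (card C)) = real ((k - 1) choose (s - 1)) * g s"
        by simp
    qed
    also have "\<dots> \<le> (\<Sum>s = 1..t. M / real K * (b ^ (s choose 2) / (z ^ s * fact (s - 1))))"
    proof (rule sum_mono)
      fix s assume s: "s \<in> {1..t}"
      show "real ((k - 1) choose (s - 1)) * g s
        \<le> M / real K * (b ^ (s choose 2) / (z ^ s * fact (s - 1)))"
      proof (cases "s \<le> k")
        case True
        have "real (((k - 1) choose (s - 1)) * fact (s - 1)) \<le> real ((k - 1) ^ (s - 1))"
          using binomial_fact_pow[of "k - 1" "s - 1"] by (simp only: of_nat_le_iff)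
        also have "\<dots> \<le> real (K ^ (s - 1))"
          using less.prems(3) by (intro of_nat_mono power_mono) auto
        finally have "real ((k - 1) choose (s - 1)) \<le> real K ^ (s - 1) / fact (s - 1)"
          by (simp add: field_simps)
        moreover have "real K ^ (s - 1) = real K ^ s / real K"
          using K s by (simp add: power_diff)
        ultimately have 1: "real ((k - 1) choose (s - 1)) \<le> real K ^ s / real K / fact (s - 1)" by simp
        have "(real K * z) ^ (k - s) = (real K * z) ^ k / (real K * z) ^ s"
          using K z True by (simp add: power_diff)
        \<comment> \<open>Pairs inside \<open>C\<close> stay unconstrained; compared with requiring
          all pairs of \<open>S\<close> to be absent, this gives the factor
          \<open>b ^ (s choose 2)\<close>.\<close>
        moreover have "(1 - p) ^ (s * (k - s)) * (1 - p) ^ (k - s choose 2)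
            = (1 - p) ^ (k choose 2) * b ^ (s choose 2)"
          unfolding choose_two_split[OF True] b using p by (simp add: power_add field_simps)
        ultimately have g: "g s = M * b ^ (s choose 2) / (real K * z) ^ s"
          unfolding g_def M_def power_add by (simp add: field_simps)
        have "g s \<ge> 0" unfolding g_def using p z by simp
        from mult_right_mono[OF 1 this] show ?thesis
          using K z by (simp add: g power_mult_distrib field_simps)
      next
        case False
        \<comment> \<open>Here \<open>k - s\<close> truncates to 0 and \<open>g s\<close> has no
          meaning, but there are no sets of size \<open>s\<close> to count.\<close>
        then have "(k - 1) choose (s - 1) = 0" using \<open>k \<noteq> 0\<close> by (intro binomial_eq_0) auto
        then have "real ((k - 1) choose (s - 1)) * g s = 0" by (metis mult_zero_left of_nat_0)
        moreover have "0 \<le> M / real K * (b ^ (s choose 2) / (z ^ s * fact (s - 1)))"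
          using M z p b by (intro mult_nonneg_nonneg divide_nonneg_nonneg) auto
        ultimately show ?thesis by linarith
      qed
    qed
    also have "\<dots> = M / real K * (\<Sum>s = 1..t. b ^ (s choose 2) / (z ^ s * fact (s - 1)))"
      by (simp add: sum_distrib_left)
    also have "\<dots> \<le> M / real K * real K"
      by (rule mult_left_mono[OF weights]) (use M in simp)
    also have "\<dots> = M" using K by simp
    finally show ?thesis unfolding M_def .
  qed
qed

text \<open>The term for size \<open>s\<close> is compared with an \<open>s\<close>-th power by
  raising \<open>s - 1\<close> to \<open>t - 1\<close> in the exponent of \<open>b\<close>. The
  hypothesis on \<open>K\<close> gives \<open>K powr (s / t) <= K * exp (s - t)\<close>, and
  \<open>t ^ s <= exp t * fact s\<close>. The factor \<open>exp 1\<close> in \<open>z\<close> is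
  chosen so that all these exponentials cancel. What remains is \<open>K * s / 4 ^ s\<close>, and 4
  makes this at most \<open>K / 2 ^ s\<close>, with sum below \<open>K\<close>.\<close>

lemma component_weights_le:
  fixes b :: real
  assumes b: "1 \<le> b" and t: "1 \<le> t" and K: "exp (real t) \<le> real K"
    and z: "z = 4 * exp 1 * b powr ((real t - 1) / 2) / (real K powr (1 / real t) * real t)"
  shows "(\<Sum>s = 1..t. b ^ (s choose 2) / (z ^ s * fact (s - 1))) \<le> real K"
proof -
  have K0: "real K > 0" using K exp_gt_zero[of "real t"] by linarith
  have "b ^ (s choose 2) / (z ^ s * fact (s - 1)) \<le> real K * (1 / 2) ^ s" if s: "s \<in> {1..t}" for s
  proof -
    have zs: "z ^ s = 4 ^ s * exp (real s) * b powr (real s * (real t - 1) / 2) / (real K powr (real s / real t) * real t ^ s)"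
      using b K0 by (simp add: z power_divide power_mult_distrib powr_power exp_of_nat_mult[symmetric] mult.commute)
    have "b ^ (s choose 2) = b powr (real s * (real s - 1) / 2)"
      using b by (simp add: powr_realpow[symmetric] choose_two_real)
    also have "\<dots> \<le> b powr (real s * (real t - 1) / 2)"
      using b s by (intro powr_mono divide_right_mono mult_left_mono) auto
    finally have 1: "b ^ (s choose 2) \<le> b powr (real s * (real t - 1) / 2)" .
    have "real K powr (real s / real t) = real K * real K powr (- ((real t - real s) / real t))"
      using K0 t by (simp add: powr_mult_base diff_divide_distrib)
    also have "real K powr (- ((real t - real s) / real t)) \<le> exp (real t) powr (- ((real t - real s) / real t))"
      using K s t by (intro powr_mono2') auto
    also have "\<dots> = exp (real s - real t)"
      using t by (simp add: powr_def)
    finally have 2: "real K powr (real s / real t) \<le> real K * exp (real s - real t)"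
      using K0 by simp
    have f: "fact s = real s * fact (s - 1)" using s by (simp add: fact_reduce)
    have 3: "real t ^ s \<le> exp (real t) * (real s * fact (s - 1))"
      using power_le_exp_fact[of t s] by (simp add: f)
    have 4: "real s \<le> 2 ^ s" using less_exp[of s] by (metis less_imp_le of_nat_le_iff of_nat_numeral of_nat_power)
    have bp: "b powr (real s * (real t - 1) / 2) > 0" using b by simp
    have "b ^ (s choose 2) / (z ^ s * fact (s - 1))
      \<le> b powr (real s * (real t - 1) / 2) / (z ^ s * fact (s - 1))"
      using 1 b K0 t by (intro divide_right_mono) (auto simp: z)
    also have "\<dots> = real K powr (real s / real t) * real t ^ s / (4 ^ s * exp (real s) * fact (s - 1))"
      unfolding zs using bp K0 t by (simp add: field_simps)
    also have "\<dots> \<le> (real K * exp (real s - real t)) * (exp (real t) * (real s * fact (s - 1))) / (4 ^ s * exp (real s) * fact (s - 1))"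
      using K0 by (intro divide_right_mono mult_mono 2 3) auto
    also have "\<dots> = real K * (real s / 4 ^ s)"
      by (simp add: exp_diff field_simps)
    also have "\<dots> \<le> real K * (2 ^ s / 4 ^ s)"
      using K0 4 by (intro mult_left_mono divide_right_mono) auto
    also have "(2::real) ^ s / 4 ^ s = (1 / 2) ^ s" by (simp add: power_divide[symmetric])
    finally show ?thesis .
  qed
  then have "(\<Sum>s = 1..t. b ^ (s choose 2) / (z ^ s * fact (s - 1))) \<le> (\<Sum>s = 1..t. real K * (1 / 2) ^ s)"
    by (rule sum_mono)
  also have "\<dots> = real K * (\<Sum>s = 1..t. (1 / 2) ^ s)" by (simp add: sum_distrib_left)
  also have "(\<Sum>s = 1..t. (1 / 2 :: real) ^ s) = 1 - (1 / 2) ^ t"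
    by (induction t) auto
  also have "real K * (1 - (1 / 2) ^ t) \<le> real K" using K0 by (simp add: mult_le_cancel_left1)
  finally show ?thesis .
qed

text \<open>The bound \<open>exp K * n ^ K / K ^ K\<close> for the binomial coefficient cancels the
  \<open>K ^ K\<close> in \<open>(K * z) ^ K\<close>. Its \<open>exp 1\<close> per vertex and the
  one in \<open>z\<close> make up \<open>exp 2\<close>.\<close>

lemma prob_alpha_t_ge_le:
  fixes p b :: real
  assumes p: "0 < p" "p < 1" and b: "b = 1 / (1 - p)" and t: "1 \<le> t" and K: "exp (real t) \<le> real K"
  shows "measure_pmf.prob (Gnp n p) {E. K \<le> alpha_t t {1..n} E}
    \<le> (4 * exp 2 * real n * b powr ((real t - real K) / 2) / (real K powr (1 / real t) * real t)) ^ K"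
proof -
  let ?P = "measure_pmf.prob (Gnp n p)"
  define z where "z = 4 * exp 1 * b powr ((real t - 1) / 2) / (real K powr (1 / real t) * real t)"
  have K0: "real K > 0" using K exp_gt_zero[of "real t"] by linarith
  have b1: "b \<ge> 1" "b > 0" using p by (auto simp: b field_simps)
  have z0: "z > 0" unfolding z_def using b1 K0 t by simp
  let ?F = "{S. S \<subseteq> {1..n} \<and> card S = K}"
  have fin: "finite ?F" by simp
  have "{E. K \<le> alpha_t t {1..n} E} = (\<Union>S\<in>?F. {E. t_component_set t {1..n} E S})"
    by (auto simp: alpha_t_ge_iff t_component_set_def)
  then have "?P {E. K \<le> alpha_t t {1..n} E} \<le> (\<Sum>S\<in>?F. ?P {E. t_component_set t {1..n} E S})"
    using measure_pmf.finite_measure_subadditive_finite[OF fin] by simp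
  also have "\<dots> \<le> (\<Sum>S\<in>?F. (real K * z) ^ K * (1 - p) ^ (K choose 2))"
  proof (rule sum_mono)
    fix S assume "S \<in> ?F"
    then show "?P {E. t_component_set t {1..n} E S} \<le> (real K * z) ^ K * (1 - p) ^ (K choose 2)"
      using prob_t_component_set_le[OF p b z0 _ component_weights_le[OF b1(1) t K z_def], of S n K "{}"] K0
      by simp
  qed
  also have "\<dots> = real (n choose K) * ((real K * z) ^ K * (1 - p) ^ (K choose 2))"
    by (simp add: n_subsets)
  also have "\<dots> \<le> (exp (real K) * (real n) ^ K / real K ^ K) * ((real K * z) ^ K * (1 - p) ^ (K choose 2))"
  proof (rule mult_right_mono)
    have "real (n choose K) * fact K \<le> real n ^ K"
      using binomial_fact_pow[of n K] by (metis of_nat_fact of_nat_le_iff of_nat_mult of_nat_power)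
    moreover have "real K ^ K \<le> exp (real K) * fact K" by (rule power_le_exp_fact)
    ultimately have "(real (n choose K) * fact K) * real K ^ K \<le> real n ^ K * (exp (real K) * fact K)"
      by (intro mult_mono) auto
    then show "real (n choose K) \<le> exp (real K) * (real n) ^ K / real K ^ K"
      using K0 by (simp add: field_simps)
  qed (use p z0 in auto)
  also have "\<dots> = (exp 1 * real n * z) ^ K * (1 - p) ^ (K choose 2)"
    using K0 by (simp add: power_mult_distrib exp_of_nat_mult[symmetric])
  also have "(1 - p) ^ (K choose 2) = (b powr (- (real K - 1) / 2)) ^ K"
  proof -
    have "(1 - p) ^ (K choose 2) = (1 / b) powr (real K * (real K - 1) / 2)"
      using p by (simp add: powr_realpow[symmetric] choose_two_real b)
    also have "\<dots> = b powr (- (real K * (real K - 1) / 2))"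
      using b1 by (simp only: powr_minus) (simp add: powr_divide inverse_eq_divide)
    also have "\<dots> = (b powr (- (real K - 1) / 2)) ^ K"
      using b1 by (simp add: powr_power algebra_simps minus_divide_left)
    finally show ?thesis .
  qed
  also have "(exp 1 * real n * z) ^ K * (b powr (- (real K - 1) / 2)) ^ K
      = (exp 1 * real n * z * b powr (- (real K - 1) / 2)) ^ K"
    by (simp add: power_mult_distrib)
  also have "exp 1 * real n * z * b powr (- (real K - 1) / 2)
     = 4 * (exp 1 * exp 1) * real n * (b powr ((real t - 1) / 2) * b powr (- (real K - 1) / 2)) / (real K powr (1 / real t) * real t)"
    by (simp add: z_def)
  also have "b powr ((real t - 1) / 2) * b powr (- (real K - 1) / 2) = b powr ((real t - real K) / 2)"
    by (simp add: powr_add[symmetric] add_divide_distrib[symmetric])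
  also have "exp 1 * exp 1 = exp (2::real)" by (simp add: exp_add[symmetric])
  finally show ?thesis .
qed

subsection \<open>The second moment\<close>

text \<open>Chebyshev's inequality: if no \<open>A i\<close> occurs, the counting variable
  \<open>X\<close> is 0 and \<open>(X - mu)^2 = mu^2\<close>. The pair sum is bounded for each
  single \<open>i\<close>, which suits embeddings, since they all look alike.\<close>

lemma prob_no_event_le:
  fixes M :: "'a pmf" and A :: "'i \<Rightarrow> 'a set"
  assumes I: "finite I" "I \<noteq> {}" and q: "0 < q"
    and prob: "\<And>i. i \<in> I \<Longrightarrow> measure_pmf.prob M (A i) = q"
    and pair: "\<And>i. i \<in> I \<Longrightarrow>
      (\<Sum>j\<in>I. measure_pmf.prob M (A i \<inter> A j)) \<le> (1 + \<epsilon>) * (real (card I) * q\<^sup>2)"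
  shows "measure_pmf.prob M {\<omega>. \<forall>i\<in>I. \<omega> \<notin> A i} \<le> \<epsilon>"
proof -
  define X where "X \<omega> = (\<Sum>i\<in>I. indicat_real (A i) \<omega>)" for \<omega>
  define \<mu> where "\<mu> = real (card I) * q"
  let ?Z = "{\<omega>. \<forall>i\<in>I. \<omega> \<notin> A i}"
  have \<mu>: "\<mu> > 0" using I q by (simp add: \<mu>_def card_gt_0_iff)
  have int: "integrable M (indicat_real S)" for S
    by (rule integrable_real_indicator) (auto simp: measure_pmf.emeasure_finite less_top[symmetric])
  have sq: "(X \<omega> - \<mu>)\<^sup>2 = (\<Sum>i\<in>I. \<Sum>j\<in>I. indicat_real (A i \<inter> A j) \<omega>) - 2 * \<mu> * X \<omega> + \<mu>\<^sup>2" for \<omega>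
    unfolding X_def
    by (simp add: power2_diff power2_eq_square sum_product indicator_inter_arith[symmetric] algebra_simps)
  have int2: "integrable M (\<lambda>\<omega>. (X \<omega> - \<mu>)\<^sup>2)"
    unfolding sq unfolding X_def by (intro Bochner_Integration.integrable_add Bochner_Integration.integrable_diff
        Bochner_Integration.integrable_sum integrable_mult_right int) simp
  have "\<mu>\<^sup>2 * measure_pmf.prob M ?Z = measure_pmf.expectation M (\<lambda>\<omega>. \<mu>\<^sup>2 * indicat_real ?Z \<omega>)"
    by simp
  also have "\<dots> \<le> measure_pmf.expectation M (\<lambda>\<omega>. (X \<omega> - \<mu>)\<^sup>2)"
  proof (rule integral_mono[OF _ int2])
    show "integrable M (\<lambda>\<omega>. \<mu>\<^sup>2 * indicat_real ?Z \<omega>)" by (intro integrable_mult_right int)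
    fix \<omega>
    have "X \<omega> = 0" if "\<omega> \<in> ?Z" using that by (simp add: X_def)
    then show "\<mu>\<^sup>2 * indicat_real ?Z \<omega> \<le> (X \<omega> - \<mu>)\<^sup>2" by (auto simp: indicator_def)
  qed
  also have "\<dots> = (\<Sum>i\<in>I. \<Sum>j\<in>I. measure_pmf.prob M (A i \<inter> A j)) - 2 * \<mu> * (\<Sum>i\<in>I. measure_pmf.prob M (A i)) + \<mu>\<^sup>2"
    unfolding sq unfolding X_def
    by (simp add: Bochner_Integration.integral_add Bochner_Integration.integral_diff
        Bochner_Integration.integral_sum int Bochner_Integration.integrable_sum
        Bochner_Integration.integrable_diff integrable_mult_right del: sum_distrib_left)
  also have "\<dots> \<le> (\<Sum>i\<in>I. (1 + \<epsilon>) * (real (card I) * q\<^sup>2)) - 2 * \<mu> * \<mu> + \<mu>\<^sup>2"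
  proof -
    have "(\<Sum>i\<in>I. measure_pmf.prob M (A i)) = \<mu>" by (simp add: prob \<mu>_def)
    then show ?thesis using sum_mono[OF pair, of I] by simp
  qed
  also have "\<dots> = \<mu>\<^sup>2 * \<epsilon>" by (simp add: \<mu>_def power2_eq_square algebra_simps)
  finally show ?thesis using \<mu> by simp
qed

text \<open>Positions \<open>{..<k}\<close> are split into \<open>m\<close> blocks by their residue modulo \<open>m\<close>; the positions
  below \<open>m\<close> are the centres of stars spanning the blocks.\<close>

definition star_edges :: "nat \<Rightarrow> nat \<Rightarrow> nat set set" where
  "star_edges m k = (\<lambda>j. {j mod m, j}) ` {m..<k}"

definition cross_edges :: "nat \<Rightarrow> nat \<Rightarrow> nat set set" where
  "cross_edges m k = {e \<in> complete_edges {..<k}. inj_on (\<lambda>i. i mod m) e}"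

definition embeddings :: "nat \<Rightarrow> nat \<Rightarrow> (nat \<Rightarrow> nat) set" where
  "embeddings k n = {x \<in> {..<k} \<rightarrow>\<^sub>E {1..n}. inj_on x {..<k}}"

text \<open>Pairs within a block that are not star edges are left free. On this event with
  \<open>0 < m\<close>, the images of the blocks are exactly the components of the subgraph induced
  on the image of \<open>x\<close>.\<close>

definition star_event :: "nat \<Rightarrow> nat \<Rightarrow> (nat \<Rightarrow> nat) \<Rightarrow> nat set set set" where
  "star_event m k x = {E. (`) x ` star_edges m k \<subseteq> E \<and> (`) x ` cross_edges m k \<inter> E = {}}"

text \<open>The common vertices are recorded by their positions under \<open>x\<close> only; where
  \<open>y\<close> puts them is counted separately.\<close>

definition overlap :: "nat \<Rightarrow> (nat \<Rightarrow> nat) \<Rightarrow> (nat \<Rightarrow> nat) \<Rightarrow> nat set" where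
  "overlap k x y = {r. r < k \<and> x r \<in> y ` {..<k}}"

lemma finite_embeddings: "finite (embeddings k n)"
  unfolding embeddings_def by (rule finite_subset[of _ "{..<k} \<rightarrow>\<^sub>E {1..n}"]) (auto intro: finite_PiE)

lemma embeddings_inj: "x \<in> embeddings k n \<Longrightarrow> inj_on x {..<k}"
  by (simp add: embeddings_def)

lemma embeddings_range: "x \<in> embeddings k n \<Longrightarrow> r < k \<Longrightarrow> x r \<in> {1..n}"
  unfolding embeddings_def by blast

lemma cross_edges_subset: "cross_edges m k \<subseteq> complete_edges {..<k}"
  by (auto simp: cross_edges_def)

lemma finite_cross_edges: "finite (cross_edges m k)"
  using cross_edges_subset finite_complete_edges[of "{..<k}"] finite_subset by blast

lemma doubleton_in_cross_edges:
  "{i, j} \<in> cross_edges m k \<longleftrightarrow> i < k \<and> j < k \<and> i mod m \<noteq> j mod m"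
  by (auto simp: cross_edges_def complete_edges_def inj_on_def card_insert_if)

lemma star_edges_subset: "0 < m \<Longrightarrow> star_edges m k \<subseteq> complete_edges {..<k}"
proof -
  assume m: "0 < m"
  have "j mod m < j" if "m \<le> j" for j using m that by (meson mod_less_divisor less_le_trans)
  then show ?thesis by (force simp: star_edges_def complete_edges_def card_insert_if)
qed

lemma card_star_edges: "0 < m \<Longrightarrow> card (star_edges m k) = k - m"
proof -
  assume m: "0 < m"
  have "inj_on (\<lambda>j. {j mod m, j}) {m..<k}"
  proof (rule inj_onI)
    fix i j assume *: "i \<in> {m..<k}" "j \<in> {m..<k}" "{i mod m, i} = {j mod m, j}"
    then have "j \<noteq> i mod m" using m mod_less_divisor[of m i] by (metis atLeastLessThan_iff leD)
    then show "i = j" using * by (auto simp: doubleton_eq_iff)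
  qed
  then show ?thesis by (simp add: star_edges_def card_image)
qed

lemma star_cross_disjoint: "0 < m \<Longrightarrow> star_edges m k \<inter> cross_edges m k = {}"
  by (auto simp: star_edges_def doubleton_in_cross_edges)

lemma inj_on_image_complete_edges:
  "inj_on x V \<Longrightarrow> inj_on ((`) x) (complete_edges V)"
  by (rule inj_on_subset[OF inj_on_image_Pow]) (auto simp: complete_edges_def)

lemma image_complete_edges:
  assumes "x \<in> embeddings k n"
  shows "(`) x ` complete_edges {..<k} \<subseteq> complete_edges {1..n}"
proof clarsimp
  fix e assume e: "e \<in> complete_edges {..<k}"
  then have "e \<subseteq> {..<k}" "card e = 2" by (auto simp: complete_edges_def)
  moreover have "card (x ` e) = card e"
    using embeddings_inj[OF assms] calculation(1) by (intro card_image) (rule inj_on_subset)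
  ultimately show "x ` e \<in> complete_edges {Suc 0..n}"
    using embeddings_range[OF assms] by (fastforce simp: complete_edges_def)
qed

lemma image_edges_subset:
  assumes "x \<in> embeddings k n" "F \<subseteq> complete_edges {..<k}"
  shows "(`) x ` F \<subseteq> complete_edges {1..n}"
  using image_mono[OF assms(2), of "(`) x"] image_complete_edges[OF assms(1)] by (rule order_trans)

lemma card_block_le:
  assumes "0 < m" "k \<le> m * t"
  shows "card {i. i < k \<and> i mod m = c} \<le> t"
proof -
  have "inj_on (\<lambda>i. i div m) {i. i < k \<and> i mod m = c}"
    by (rule inj_onI) (metis (mono_tags, lifting) div_mult_mod_eq mem_Collect_eq)
  moreover have "(\<lambda>i. i div m) ` {i. i < k \<and> i mod m = c} \<subseteq> {..<t}"
    using assms by (auto simp: less_mult_imp_div_less mult.commute)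
  ultimately have "card {i. i < k \<and> i mod m = c} \<le> card {..<t}"
    by (rule card_inj_on_le) simp
  then show ?thesis by simp
qed

lemma star_event_alpha_t:
  assumes m: "0 < m" "k \<le> m * t" and x: "x \<in> embeddings k n" and E: "E \<in> star_event m k x"
  shows "k \<le> alpha_t t {1..n} E"
proof -
  let ?i = "inv_into {..<k} x"
  have inj: "inj_on x {..<k}" using embeddings_inj[OF x] .
  have "t_component_set t {1..n} E (x ` {..<k})"
  proof (rule t_component_set_blocks[where f = "\<lambda>v. ?i v mod m"])
    show "x ` {..<k} \<subseteq> {1..n}" using embeddings_range[OF x] by auto
    fix u v assume "u \<in> x ` {..<k}" "v \<in> x ` {..<k}" and ne: "?i u mod m \<noteq> ?i v mod m"
    then obtain i j where ij: "u = x i" "v = x j" "i < k" "j < k" by auto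
    then have "{i, j} \<in> cross_edges m k" using ne inj by (simp add: doubleton_in_cross_edges)
    then have "x ` {i, j} \<in> (`) x ` cross_edges m k" by (rule imageI)
    then show "{u, v} \<notin> E" using E ij by (auto simp: star_event_def)
  next
    fix c
    have "{v \<in> x ` {..<k}. ?i v mod m = c} \<subseteq> x ` {i. i < k \<and> i mod m = c}"
      using inj by auto
    then have "card {v \<in> x ` {..<k}. ?i v mod m = c} \<le> card (x ` {i. i < k \<and> i mod m = c})"
      by (intro card_mono) auto
    also have "\<dots> \<le> card {i. i < k \<and> i mod m = c}" by (rule card_image_le) simp
    also have "\<dots> \<le> t" by (rule card_block_le[OF m])
    finally show "card {v \<in> x ` {..<k}. ?i v mod m = c} \<le> t" .
  qed simp
  moreover have "card (x ` {..<k}) = k" using inj by (simp add: card_image)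
  ultimately show ?thesis by (auto simp: alpha_t_ge_iff)
qed

lemma card_image_edges:
  assumes "x \<in> embeddings k n" "F \<subseteq> complete_edges {..<k}"
  shows "card ((`) x ` F) = card F"
  using inj_on_image_complete_edges[OF embeddings_inj[OF assms(1)]] assms(2)
  by (intro card_image) (rule inj_on_subset)

lemma prob_star_event:
  assumes p: "0 < p" "p < 1" and m: "0 < m" and x: "x \<in> embeddings k n"
  shows "measure_pmf.prob (Gnp n p) (star_event m k x) = p ^ (k - m) * (1 - p) ^ card (cross_edges m k)"
proof -
  have "(`) x ` star_edges m k \<inter> (`) x ` cross_edges m k = (`) x ` (star_edges m k \<inter> cross_edges m k)"
    by (rule inj_on_image_Int[symmetric, OF inj_on_image_complete_edges[OF embeddings_inj[OF x]]
          star_edges_subset[OF m] cross_edges_subset])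
  also have "\<dots> = {}" by (simp add: star_cross_disjoint[OF m])
  finally have "measure_pmf.prob (Gnp n p) (star_event m k x)
      = p ^ card ((`) x ` star_edges m k) * (1 - p) ^ card ((`) x ` cross_edges m k)"
    unfolding star_event_def
    by (intro prob_Gnp_present_absent[OF p] image_edges_subset[OF x] star_edges_subset[OF m] cross_edges_subset)
  then show ?thesis
    by (simp add: card_image_edges[OF x star_edges_subset[OF m]]
        card_image_edges[OF x cross_edges_subset] card_star_edges[OF m])
qed

section \<open>Joint probability of two star events\<close>

lemma image_edges_Int:
  assumes x: "x \<in> embeddings k n" and F: "F \<subseteq> complete_edges {..<k}" "F' \<subseteq> complete_edges {..<k}"
  shows "card ((`) x ` F \<inter> (`) y ` F') \<le> card {e \<in> F. e \<subseteq> overlap k x y}"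
proof -
  have fin: "finite F" using F(1) finite_complete_edges[of "{..<k}"] finite_subset by blast
  have "(`) x ` F \<inter> (`) y ` F' \<subseteq> (`) x ` {e \<in> F. e \<subseteq> overlap k x y}"
  proof
    fix d assume "d \<in> (`) x ` F \<inter> (`) y ` F'"
    then obtain e e' where e: "e \<in> F" "x ` e = y ` e'" "e' \<in> F'" and d: "d = x ` e" by auto
    then have "e \<subseteq> {..<k}" "e' \<subseteq> {..<k}" using F by (auto simp: complete_edges_def)
    then have "e \<subseteq> overlap k x y" using e(2) by (fastforce simp: overlap_def)
    then show "d \<in> (`) x ` {e \<in> F. e \<subseteq> overlap k x y}"
      unfolding d using e(1) by (intro imageI) simp
  qed
  then have "card ((`) x ` F \<inter> (`) y ` F') \<le> card ((`) x ` {e \<in> F. e \<subseteq> overlap k x y})"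
    using fin by (intro card_mono) auto
  also have "\<dots> \<le> card {e \<in> F. e \<subseteq> overlap k x y}" using fin by (intro card_image_le) auto
  finally show ?thesis .
qed

text \<open>Inclusion-exclusion for the required edges and for the forbidden ones: only shared pairs
  make the joint probability exceed \<open>q^2\<close>. A shared star edge is named by its leaf,
  which lies in the overlap, so there are at most as many as overlap positions; shared forbidden
  pairs are cross edges of \<open>x\<close> inside the overlap. If one embedding requires what the
  other forbids, the events are disjoint.\<close>

lemma prob_two_star_events_le:
  assumes p: "0 < p" "p < 1" and m: "0 < m" and x: "x \<in> embeddings k n" and y: "y \<in> embeddings k n"
    and q: "q = p ^ (k - m) * (1 - p) ^ card (cross_edges m k)"
  shows "measure_pmf.prob (Gnp n p) (star_event m k x \<inter> star_event m k y)
    \<le> q\<^sup>2 / (p ^ card (overlap k x y) * (1 - p) ^ card {e \<in> cross_edges m k. e \<subseteq> overlap k x y})"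
proof -
  let ?P = "measure_pmf.prob (Gnp n p)" and ?R = "overlap k x y"
  let ?S = "star_edges m k" and ?C = "cross_edges m k"
  define U where "U = (`) x ` ?S \<union> (`) y ` ?S"
  define W where "W = (`) x ` ?C \<union> (`) y ` ?C"
  have eq: "star_event m k x \<inter> star_event m k y = {E. U \<subseteq> E \<and> W \<inter> E = {}}"
    by (auto simp: star_event_def U_def W_def)
  have finR: "finite ?R" by (simp add: overlap_def)
  show ?thesis
  proof (cases "U \<inter> W = {}")
    case True
    have P: "?P (star_event m k x \<inter> star_event m k y) = p ^ card U * (1 - p) ^ card W"
      unfolding eq U_def W_def
      by (intro prob_Gnp_present_absent[OF p] Un_least image_edges_subset[OF x] image_edges_subset[OF y]
          star_edges_subset[OF m] cross_edges_subset True[unfolded U_def W_def])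
    have finS: "finite ?S" by (simp add: star_edges_def)
    have "card U + card ((`) x ` ?S \<inter> (`) y ` ?S) = 2 * (k - m)"
      unfolding U_def using card_Un_Int[of "(`) x ` ?S" "(`) y ` ?S"] finS
      by (simp add: card_image_edges[OF x star_edges_subset[OF m]]
          card_image_edges[OF y star_edges_subset[OF m]] card_star_edges[OF m])
    moreover have "card ((`) x ` ?S \<inter> (`) y ` ?S) \<le> card ?R"
    proof -
      have "{e \<in> ?S. e \<subseteq> ?R} \<subseteq> (\<lambda>j. {j mod m, j}) ` ?R" by (auto simp: star_edges_def)
      then have "card {e \<in> ?S. e \<subseteq> ?R} \<le> card ((\<lambda>j. {j mod m, j}) ` ?R)"
        using finR by (intro card_mono) auto
      also have "\<dots> \<le> card ?R" by (rule card_image_le[OF finR])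
      finally show ?thesis
        using image_edges_Int[OF x star_edges_subset[OF m] star_edges_subset[OF m], of y] by simp
    qed
    ultimately have cU: "2 * (k - m) \<le> card U + card ?R" by simp
    have "card W + card ((`) x ` ?C \<inter> (`) y ` ?C) = 2 * card ?C"
      unfolding W_def using card_Un_Int[of "(`) x ` ?C" "(`) y ` ?C"] finite_cross_edges[of m k]
      by (simp add: card_image_edges[OF x cross_edges_subset] card_image_edges[OF y cross_edges_subset])
    then have cW: "2 * card ?C \<le> card W + card {e \<in> ?C. e \<subseteq> ?R}"
      using image_edges_Int[OF x cross_edges_subset cross_edges_subset, of m y m] by simp
    have "?P (star_event m k x \<inter> star_event m k y) * (p ^ card ?R * (1 - p) ^ card {e \<in> ?C. e \<subseteq> ?R})
      = p ^ (card U + card ?R) * (1 - p) ^ (card W + card {e \<in> ?C. e \<subseteq> ?R})"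
      by (simp add: P power_add)
    also have "\<dots> \<le> p ^ (2 * (k - m)) * (1 - p) ^ (2 * card ?C)"
      using p by (intro mult_mono power_decreasing cU cW) auto
    also have "\<dots> = q\<^sup>2" unfolding q power_mult_distrib by (simp add: power_mult[symmetric] mult.commute)
    finally show ?thesis using p by (simp add: field_simps)
  next
    case False
    then have "star_event m k x \<inter> star_event m k y = {}" unfolding eq by auto
    then show ?thesis using p by simp
  qed
qed

text \<open>A Turan-type bound: by Cauchy-Schwarz over the \<open>m\<close> residue classes, at
  least a fraction \<open>1 / m\<close> of the ordered pairs in \<open>R\<close>, diagonal included,
  have equal residues. The gain \<open>1 / m\<close> is essential, since it produces the term
  \<open>t\<close> of the estimate.\<close>

lemma card_cross_edges_within_le:
  assumes R: "finite R" and m: "0 < m"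
  shows "real (card {e \<in> cross_edges m k. e \<subseteq> R}) \<le> (real (card R))\<^sup>2 * (1 - 1 / real m) / 2"
proof -
  define D where "D = {(i, j) \<in> R \<times> R. i mod m \<noteq> j mod m}"
  define Q where "Q = {(i, j) \<in> R \<times> R. i mod m = j mod m}"
  define L where "L = {(i, j) \<in> R \<times> R. i < j \<and> i mod m \<noteq> j mod m}"
  have fin: "finite D" "finite Q" "finite L"
    by (rule finite_subset[of _ "R \<times> R"]; use R in \<open>auto simp: D_def Q_def L_def\<close>)+
  have D: "D = L \<union> prod.swap ` L" by (auto simp: D_def L_def image_def) (metis linorder_neqE_nat)
  have "card D = card L + card (prod.swap ` L)"
    unfolding D using fin by (intro card_Un_disjoint) (auto simp: L_def)
  also have "card (prod.swap ` L) = card L" by (rule card_image) simp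
  finally have DL: "card D = 2 * card L" by simp
  have "{e \<in> cross_edges m k. e \<subseteq> R} \<subseteq> (\<lambda>(i, j). {i, j}) ` L"
  proof clarify
    fix e assume e: "e \<in> cross_edges m k" "e \<subseteq> R"
    then have "card e = 2" by (auto simp: cross_edges_def complete_edges_def)
    then obtain i j where ij: "e = {i, j}" "i \<noteq> j" by (meson card_2_iff)
    have "i mod m \<noteq> j mod m" using e ij by (simp add: doubleton_in_cross_edges)
    then have "(min i j, max i j) \<in> L" using e ij by (auto simp: L_def min_def max_def)
    then show "e \<in> (\<lambda>(i, j). {i, j}) ` L"
      by (rule rev_image_eqI) (auto simp: ij min_def max_def)
  qed
  then have "card {e \<in> cross_edges m k. e \<subseteq> R} \<le> card ((\<lambda>(i, j). {i, j}) ` L)"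
    using fin by (intro card_mono) auto
  also have "\<dots> \<le> card L" by (rule card_image_le) (use fin in simp)
  finally have 1: "2 * card {e \<in> cross_edges m k. e \<subseteq> R} \<le> card D" using DL by simp
  have "card (D \<union> Q) = card D + card Q" using fin by (intro card_Un_disjoint) (auto simp: D_def Q_def)
  moreover have "D \<union> Q = R \<times> R" by (auto simp: D_def Q_def)
  ultimately have 2: "card D + card Q = (card R)\<^sup>2" by (simp add: power2_eq_square card_cartesian_product)
  define B where "B c = {i \<in> R. i mod m = c}" for c
  have "Q = (\<Union>c\<in>{..<m}. B c \<times> B c)"
    using mod_less_divisor[OF m] by (fastforce simp: Q_def B_def)
  moreover have "card (\<Union>c\<in>{..<m}. B c \<times> B c) = (\<Sum>c<m. card (B c \<times> B c))"
    using R by (intro card_UN_disjoint) (auto simp: B_def)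
  ultimately have "card Q = (\<Sum>c<m. card (B c \<times> B c))" by simp
  then have 3: "real (card Q) = (\<Sum>c<m. (real (card (B c)))\<^sup>2)"
    by (simp add: card_cartesian_product power2_eq_square)
  have "R = (\<Union>c\<in>{..<m}. B c)" using mod_less_divisor[OF m] by (fastforce simp: B_def)
  moreover have "card (\<Union>c\<in>{..<m}. B c) = (\<Sum>c<m. card (B c))"
    using R by (intro card_UN_disjoint) (auto simp: B_def)
  ultimately have "card R = (\<Sum>c<m. card (B c))" by simp
  then have "(real (card R))\<^sup>2 = (\<Sum>c<m. real (card (B c)))\<^sup>2" by simp
  also have "\<dots> \<le> real m * (\<Sum>c<m. (real (card (B c)))\<^sup>2)"
    using sum_squared_le_sum_of_squares[of "\<lambda>c. real (card (B c))" "{..<m}"] by (simp add: mult.commute)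
  finally have 4: "(real (card R))\<^sup>2 / real m \<le> real (card Q)" using m by (simp add: 3 field_simps)
  have "real (card D) + real (card Q) = (real (card R))\<^sup>2"
    using 2 by (metis of_nat_add of_nat_power)
  with 1 4 show ?thesis by (simp add: algebra_simps)
qed

section \<open>Counting embeddings with a given overlap\<close>

lemma card_le_fibres:
  assumes "finite A" "finite B" "f ` A \<subseteq> B" and "\<And>b. b \<in> B \<Longrightarrow> card {a \<in> A. f a = b} \<le> M"
  shows "card A \<le> card B * M"
proof -
  have "card A = (\<Sum>b\<in>B. card {a \<in> A. f a = b})"
    using sum.group[OF assms(1-3), of "\<lambda>_. 1 :: nat"] by simp
  also have "\<dots> \<le> (\<Sum>b\<in>B. M)" by (rule sum_mono) (rule assms(4))
  finally show ?thesis by simp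
qed

text \<open>If an embedding \<open>y\<close> meets \<open>x\<close> exactly in the positions \<open>R\<close> and is compatible with \<open>x\<close>,
  then a leaf whose centre also lies in \<open>R\<close> must go to the block of its centre. The other
  positions of \<open>R\<close> are unrestricted.\<close>

definition free_positions :: "nat \<Rightarrow> nat set \<Rightarrow> nat set" where
  "free_positions m R = {r \<in> R. r < m \<or> r mod m \<notin> R}"

text \<open>Centres account for the summand \<open>m\<close>. A leaf is free only if its centre is
  missing from \<open>R\<close>, and every missing position is the centre of a block of at most
  \<open>t\<close>.\<close>

lemma card_free_positions_le:
  assumes m: "0 < m" "k \<le> m * t" and R: "R \<subseteq> {..<k}"
  shows "card (free_positions m R) \<le> m + (k - card R) * t"
proof -
  let ?B = "\<lambda>c. {i. i < k \<and> i mod m = c}"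
  have finR: "finite R" using R finite_subset by blast
  have "free_positions m R \<subseteq> {..<m} \<union> (\<Union>c\<in>{..<k} - R. ?B c)"
  proof
    fix r assume r: "r \<in> free_positions m R"
    then have "r < k" using R by (auto simp: free_positions_def)
    moreover have "r mod m < k" using \<open>r < k\<close> by (meson le_less_trans mod_less_eq_dividend)
    ultimately show "r \<in> {..<m} \<union> (\<Union>c\<in>{..<k} - R. ?B c)"
      using r by (auto simp: free_positions_def)
  qed
  then have "card (free_positions m R) \<le> card ({..<m} \<union> (\<Union>c\<in>{..<k} - R. ?B c))"
    by (intro card_mono) auto
  also have "\<dots> \<le> card {..<m} + card (\<Union>c\<in>{..<k} - R. ?B c)" by (rule card_Un_le)
  also have "card (\<Union>c\<in>{..<k} - R. ?B c) \<le> (\<Sum>c\<in>{..<k} - R. card (?B c))"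
    by (rule card_UN_le) simp
  also have "\<dots> \<le> (\<Sum>c\<in>{..<k} - R. t)" by (intro sum_mono card_block_le[OF m])
  also have "\<dots> = (k - card R) * t" using R finR by (simp add: card_Diff_subset)
  finally show ?thesis by simp
qed

text \<open>An embedding \<open>y\<close> is encoded by where it places the vertices shared with
  \<open>x\<close>. For a free position this is any of \<open>k\<close> places; for any other one
  the centre already fixes the residue modulo \<open>m\<close>, so only the quotient, below
  \<open>t\<close>, is stored. The code determines \<open>y\<close> on the shared vertices, and each
  of the other \<open>k - card R\<close> positions has at most \<open>n\<close> values.\<close>

lemma card_compatible_embeddings_le:
  assumes m: "0 < m" "k \<le> m * t" and x: "x \<in> embeddings k n" and R: "R \<subseteq> {..<k}"
  shows "card {y \<in> embeddings k n. overlap k x y = R \<and> (`) x ` star_edges m k \<inter> (`) y ` cross_edges m k = {}}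
    \<le> k ^ card (free_positions m R) * t ^ card (R - free_positions m R) * n ^ (k - card R)"
proof -
  define Y where "Y = {y \<in> embeddings k n. overlap k x y = R \<and> (`) x ` star_edges m k \<inter> (`) y ` cross_edges m k = {}}"
  define pos where "pos y r = inv_into {..<k} y (x r)" for y r
  let ?R0 = "free_positions m R"
  define code where "code y = (\<lambda>r\<in>R. if r \<in> ?R0 then pos y r else pos y r div m)" for y
  define codes where "codes = (\<Pi>\<^sub>E r\<in>R. if r \<in> ?R0 then {..<k} else {..<t})"
  have finR: "finite R" using R finite_subset by blast
  have finY: "finite Y" unfolding Y_def using finite_embeddings by simp
  have emb: "y \<in> embeddings k n" if "y \<in> Y" for y using that by (simp add: Y_def)
  have img: "x r \<in> y ` {..<k}" if "y \<in> Y" "r \<in> R" for y r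
    using that by (auto simp: Y_def overlap_def)
  have pos_less: "pos y r < k" if "y \<in> Y" "r \<in> R" for y r
    using inv_into_into[OF img[OF that]] by (simp add: pos_def)
  have pos_eq: "y (pos y r) = x r" if "y \<in> Y" "r \<in> R" for y r
    unfolding pos_def by (rule f_inv_into_f[OF img[OF that]])
  \<comment> \<open>This is where compatibility enters: a star edge required by \<open>x\<close>
    cannot join two different blocks of \<open>y\<close>.\<close>
  have same_block: "pos y r mod m = pos y (r mod m) mod m"
    if y: "y \<in> Y" and r: "r \<in> R" "r \<notin> ?R0" for y r
  proof (rule ccontr)
    assume ne: "\<not> ?thesis"
    have r': "m \<le> r" "r mod m \<in> R" using r by (auto simp: free_positions_def)
    have "{pos y (r mod m), pos y r} \<in> cross_edges m k"
      using ne pos_less[OF y r(1)] pos_less[OF y r'(2)] by (auto simp: doubleton_in_cross_edges)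
    then have "y ` {pos y (r mod m), pos y r} \<in> (`) y ` cross_edges m k" by (rule imageI)
    moreover have "y ` {pos y (r mod m), pos y r} = x ` {r mod m, r}"
      using pos_eq[OF y r(1)] pos_eq[OF y r'(2)] by simp
    moreover have "{r mod m, r} \<in> star_edges m k"
      using r' r(1) R unfolding star_edges_def by (intro image_eqI[of _ _ r]) auto
    ultimately have "(`) x ` star_edges m k \<inter> (`) y ` cross_edges m k \<noteq> {}" by blast
    then show False using y by (simp add: Y_def)
  qed
  have "card Y \<le> card codes * n ^ (k - card R)"
  proof (rule card_le_fibres[OF finY, of _ code])
    show "finite codes" unfolding codes_def using finR by (intro finite_PiE) auto
    show "code ` Y \<subseteq> codes"
    proof
      fix c assume "c \<in> code ` Y"
      then obtain y where y: "y \<in> Y" "c = code y" by auto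
      have "pos y r div m < t" if "r \<in> R" for r
        using pos_less[OF y(1) that] m by (simp add: less_mult_imp_div_less mult.commute)
      then show "c \<in> codes"
        using pos_less[OF y(1)] by (auto simp: y(2) code_def codes_def PiE_iff extensional_def)
    qed
    fix c
    show "card {y \<in> Y. code y = c} \<le> n ^ (k - card R)"
    proof (cases "{y \<in> Y. code y = c} = {}")
      case True
      then show ?thesis by (simp only: card.empty le0)
    next
      case False
      then obtain y0 where y0: "y0 \<in> Y" "code y0 = c" by auto
      have same: "pos y r = pos y0 r" if y: "y \<in> Y" "code y = c" and r: "r \<in> R" for y r
      proof -
        have eq: "code y s = code y0 s" for s using y y0 by simp
        show ?thesis
        proof (cases "r \<in> ?R0")
          case True
          then show ?thesis using eq[of r] r by (simp add: code_def)
        next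
          case F: False
          \<comment> \<open>The centre of a leaf that is not free is itself free, being below
            \<open>m\<close>, so its code is its full position and the decoding takes one
            step.\<close>
          then have r': "r mod m \<in> R" "r mod m \<in> ?R0"
            using r m by (auto simp: free_positions_def)
          have "pos y (r mod m) = pos y0 (r mod m)" using eq[of "r mod m"] r' by (simp add: code_def)
          then have "pos y r mod m = pos y0 r mod m"
            using same_block[OF y(1) r F] same_block[OF y0(1) r F] by simp
          moreover have "pos y r div m = pos y0 r div m" using eq[of r] r F by (simp add: code_def)
          ultimately show ?thesis by (metis div_mult_mod_eq)
        qed
      qed
      define D where "D = {..<k} - pos y0 ` R"
      have "inj_on (pos y0) R"
      proof (rule inj_onI)
        fix r s assume rs: "r \<in> R" "s \<in> R" "pos y0 r = pos y0 s"
        then have "x r = x s" using pos_eq[OF y0(1)] by metis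
        then show "r = s" using embeddings_inj[OF x] rs R by (meson inj_onD subsetD)
      qed
      then have "card (pos y0 ` R) = card R" by (rule card_image)
      moreover have "pos y0 ` R \<subseteq> {..<k}" using pos_less[OF y0(1)] by auto
      ultimately have cD: "card D = k - card R" unfolding D_def using finR by (simp add: card_Diff_subset)
      have "inj_on (\<lambda>y. restrict y D) {y \<in> Y. code y = c}"
      proof (rule inj_onI)
        fix y y' assume y: "y \<in> {y \<in> Y. code y = c}" and y': "y' \<in> {y \<in> Y. code y = c}"
          and eq: "restrict y D = restrict y' D"
        show "y = y'"
        proof (rule PiE_ext)
          show "y \<in> {..<k} \<rightarrow>\<^sub>E {1..n}" "y' \<in> {..<k} \<rightarrow>\<^sub>E {1..n}"
            using emb[of y] emb[of y'] y y' by (simp_all add: embeddings_def)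
          fix i assume i: "i \<in> {..<k}"
          show "y i = y' i"
          proof (cases "i \<in> D")
            case True
            then show ?thesis using fun_cong[OF eq, of i] by simp
          next
            case False
            then obtain r where r: "r \<in> R" "i = pos y0 r" using i by (auto simp: D_def)
            have "y i = x r" using pos_eq[of y r] same[of y r] y r by simp
            moreover have "y' i = x r" using pos_eq[of y' r] same[of y' r] y' r by simp
            ultimately show ?thesis by simp
          qed
        qed
      qed
      moreover have "(\<lambda>y. restrict y D) ` {y \<in> Y. code y = c} \<subseteq> D \<rightarrow>\<^sub>E {1..n}"
        using embeddings_range[OF emb] by (fastforce simp: D_def)
      ultimately have "card {y \<in> Y. code y = c} \<le> card (D \<rightarrow>\<^sub>E {1..n})"
        by (rule card_inj_on_le) (auto simp: D_def intro!: finite_PiE)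
      also have "\<dots> = n ^ (k - card R)" using cD by (simp add: card_PiE D_def)
      finally show ?thesis .
    qed
  qed
  also have "card codes = k ^ card ?R0 * t ^ card (R - ?R0)"
  proof -
    have "card codes = (\<Prod>r\<in>R. if r \<in> ?R0 then k else t)"
      unfolding codes_def using finR by (subst card_PiE) (auto intro!: prod.cong)
    also have "\<dots> = k ^ card (R \<inter> {r. r \<in> ?R0}) * t ^ card (R \<inter> - {r. r \<in> ?R0})"
      unfolding prod.If_cases[OF finR] by simp
    also have "R \<inter> {r. r \<in> ?R0} = ?R0" by (auto simp: free_positions_def)
    also have "R \<inter> - {r. r \<in> ?R0} = R - ?R0" by auto
    finally show ?thesis .
  qed
  finally show ?thesis unfolding Y_def .
qed

text \<open>In units of \<open>q^2\<close>, this bounds what all \<open>y\<close> with overlap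
  exactly \<open>R\<close> contribute to the pair sum: the number of compatible \<open>y\<close>
  times the correlation factor of the pair bound.\<close>

definition overlap_weight :: "real \<Rightarrow> nat \<Rightarrow> nat \<Rightarrow> nat \<Rightarrow> nat \<Rightarrow> nat set \<Rightarrow> real" where
  "overlap_weight p m k t n R =
     real (k ^ card (free_positions m R) * t ^ card (R - free_positions m R) * n ^ (k - card R))
       / (p ^ card R * (1 - p) ^ card {e \<in> cross_edges m k. e \<subseteq> R})"

text \<open>The overlap \<open>{}\<close> is kept apart because it yields the main term: its pairs
  have joint probability at most \<open>q^2\<close>. All other overlaps are error terms, and
  incompatible \<open>y\<close> contribute nothing.\<close>

lemma sum_two_star_events_le:
  assumes p: "0 < p" "p < 1" and m: "0 < m" "k \<le> m * t" and x: "x \<in> embeddings k n"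
    and q: "q = p ^ (k - m) * (1 - p) ^ card (cross_edges m k)"
  shows "(\<Sum>y\<in>embeddings k n. measure_pmf.prob (Gnp n p) (star_event m k x \<inter> star_event m k y))
    \<le> q\<^sup>2 * (real (card (embeddings k n)) + (\<Sum>R\<in>Pow {..<k} - {{}}. overlap_weight p m k t n R))"
proof -
  define P where "P y = measure_pmf.prob (Gnp n p) (star_event m k x \<inter> star_event m k y)" for y
  let ?em = "embeddings k n"
  let ?Y = "\<lambda>R. {y \<in> ?em. overlap k x y = R}"
  define w where "w R = q\<^sup>2 / (p ^ card R * (1 - p) ^ card {e \<in> cross_edges m k. e \<subseteq> R})" for R
  have w0: "w R \<ge> 0" for R using p by (simp add: w_def)
  have P_le: "P y \<le> w (overlap k x y)" if "y \<in> ?em" for y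
    unfolding P_def w_def by (rule prob_two_star_events_le[OF p m(1) x that q])
  have P0: "P y = 0" if "(`) x ` star_edges m k \<inter> (`) y ` cross_edges m k \<noteq> {}" for y
  proof -
    have "star_event m k x \<inter> star_event m k y = {}" using that unfolding star_event_def by blast
    then show ?thesis by (simp add: P_def)
  qed
  have "{e \<in> cross_edges m k. e \<subseteq> {}} = {}" by (auto simp: cross_edges_def complete_edges_def)
  then have w_empty: "w {} = q\<^sup>2" unfolding w_def by (simp only: card.empty) simp
  have empty: "(\<Sum>y\<in>?Y {}. P y) \<le> q\<^sup>2 * real (card ?em)"
  proof -
    have "(\<Sum>y\<in>?Y {}. P y) \<le> (\<Sum>y\<in>?Y {}. q\<^sup>2)"
      using P_le w_empty by (intro sum_mono) force
    also have "\<dots> \<le> (\<Sum>y\<in>?em. q\<^sup>2)" by (rule sum_mono2) (auto simp: finite_embeddings)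
    finally show ?thesis by (simp add: mult.commute)
  qed
  have nonempty: "(\<Sum>y\<in>?Y R. P y) \<le> q\<^sup>2 * overlap_weight p m k t n R" if R: "R \<subseteq> {..<k}" for R
  proof -
    let ?Y' = "{y \<in> ?em. overlap k x y = R \<and> (`) x ` star_edges m k \<inter> (`) y ` cross_edges m k = {}}"
    have "(\<Sum>y\<in>?Y R. P y) = (\<Sum>y\<in>?Y'. P y)"
      by (rule sum.mono_neutral_right) (use P0 in \<open>auto simp: finite_embeddings\<close>)
    also have "\<dots> \<le> (\<Sum>y\<in>?Y'. w R)" using P_le by (intro sum_mono) auto
    also have "\<dots> = real (card ?Y') * w R" by simp
    also have "\<dots> \<le> real (k ^ card (free_positions m R) * t ^ card (R - free_positions m R) * n ^ (k - card R)) * w R"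
      by (intro mult_right_mono w0 of_nat_mono card_compatible_embeddings_le[OF m x R])
    also have "\<dots> = q\<^sup>2 * overlap_weight p m k t n R" by (simp add: w_def overlap_weight_def)
    finally show ?thesis .
  qed
  have "(\<Sum>y\<in>?em. P y) = (\<Sum>R\<in>Pow {..<k}. \<Sum>y\<in>?Y R. P y)"
    by (rule sum.group[symmetric]) (auto simp: finite_embeddings overlap_def)
  also have "\<dots> = (\<Sum>y\<in>?Y {}. P y) + (\<Sum>R\<in>Pow {..<k} - {{}}. \<Sum>y\<in>?Y R. P y)"
    by (rule sum.remove) auto
  also have "\<dots> \<le> q\<^sup>2 * real (card ?em) + (\<Sum>R\<in>Pow {..<k} - {{}}. q\<^sup>2 * overlap_weight p m k t n R)"
    by (intro add_mono empty sum_mono nonempty) auto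
  finally show ?thesis unfolding P_def by (simp add: distrib_left sum_distrib_left)
qed

section \<open>Weights of small and large overlaps\<close>

lemma inverse_powr_cross_edges_le:
  fixes p b :: real
  assumes p: "0 < p" "p < 1" and b: "b = 1 / (1 - p)" and m: "0 < m" and R: "finite R"
  shows "1 / (1 - p) ^ card {e \<in> cross_edges m k. e \<subseteq> R}
    \<le> b powr (real (card R) * (real (card R) * (1 - 1 / real m) / 2))"
proof -
  have b1: "b > 1" using p by (simp add: b)
  have "1 / (1 - p) ^ card {e \<in> cross_edges m k. e \<subseteq> R} = b powr real (card {e \<in> cross_edges m k. e \<subseteq> R})"
    using b1 by (subst powr_realpow) (use p in \<open>auto simp: b power_divide\<close>)
  also have "\<dots> \<le> b powr ((real (card R))\<^sup>2 * (1 - 1 / real m) / 2)"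
    using b1 by (intro powr_mono card_cross_edges_within_le[OF R m]) auto
  finally show ?thesis by (simp add: power2_eq_square mult.assoc)
qed

text \<open>Up to half of the positions, the crude count of \<open>k\<close> places per shared
  vertex is enough. In the application \<open>k\<close> is about \<open>2 * log b n\<close>, so
  \<open>b powr (k / 4)\<close> is about the square root of \<open>n\<close> up to a power of
  \<open>log n\<close>, and the base of the power is small.\<close>

lemma overlap_weight_small:
  fixes p b :: real
  assumes p: "0 < p" "p < 1" and b: "b = 1 / (1 - p)" and m: "0 < m" and R: "R \<subseteq> {..<k}"
    and t: "t \<le> k" and n: "0 < n" and small: "2 * card R \<le> k"
  shows "overlap_weight p m k t n R \<le> real n ^ k * (real k * b powr (real k / 4) / (real n * p)) ^ card R"
proof -
  let ?r = "card R" and ?R0 = "free_positions m R"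
  have b1: "b > 1" using p by (simp add: b)
  have finR: "finite R" using R finite_subset by blast
  have sub: "?R0 \<subseteq> R" by (auto simp: free_positions_def)
  have "k ^ card ?R0 * t ^ card (R - ?R0) \<le> k ^ card ?R0 * k ^ card (R - ?R0)"
    using t by (intro mult_left_mono power_mono) auto
  also have "\<dots> = k ^ (card ?R0 + card (R - ?R0))" by (simp add: power_add)
  also have "card ?R0 + card (R - ?R0) = ?r"
    using sub finR by (metis card_Diff_subset card_mono finite_subset le_add_diff_inverse)
  finally have "k ^ card ?R0 * t ^ card (R - ?R0) * n ^ (k - ?r) \<le> k ^ ?r * n ^ (k - ?r)"
    by (rule mult_right_mono) simp
  then have 1: "real (k ^ card ?R0 * t ^ card (R - ?R0) * n ^ (k - ?r)) \<le> real k ^ ?r * real n ^ (k - ?r)"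
    by (metis of_nat_le_iff of_nat_mult of_nat_power)
  have "real ?r * (1 - 1 / real m) / 2 \<le> real ?r * 1 / 2"
    by (intro divide_right_mono mult_left_mono) auto
  also have "\<dots> \<le> real k / 4" using small by simp
  finally have "1 / (1 - p) ^ card {e \<in> cross_edges m k. e \<subseteq> R} \<le> b powr (real ?r * (real k / 4))"
    using b1 by (intro order_trans[OF inverse_powr_cross_edges_le[OF p b m finR]] powr_mono mult_left_mono) auto
  also have "\<dots> = (b powr (real k / 4)) ^ ?r" using b1 by (simp add: powr_power mult.commute)
  finally have 2: "1 / (1 - p) ^ card {e \<in> cross_edges m k. e \<subseteq> R} \<le> (b powr (real k / 4)) ^ ?r" .
  have "?r \<le> k" using small by simp
  then have 3: "real n ^ (k - ?r) = real n ^ k / real n ^ ?r" using n by (simp add: power_diff)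
  have "overlap_weight p m k t n R = real (k ^ card ?R0 * t ^ card (R - ?R0) * n ^ (k - ?r))
     * (1 / (1 - p) ^ card {e \<in> cross_edges m k. e \<subseteq> R}) / p ^ ?r"
    by (simp add: overlap_weight_def mult.commute)
  also have "\<dots> \<le> (real k ^ ?r * real n ^ (k - ?r)) * (b powr (real k / 4)) ^ ?r / p ^ ?r"
    using p by (intro divide_right_mono mult_mono 1 2) auto
  also have "\<dots> = real n ^ k * (real k * b powr (real k / 4) / (real n * p)) ^ ?r"
    unfolding 3 by (simp add: power_mult_distrib power_divide)
  finally show ?thesis .
qed

text \<open>This range determines the threshold on \<open>n\<close>. With \<open>D\<close> positions
  missing from the overlap, up to \<open>D * t\<close> leaves become free at a cost of
  \<open>k\<close> each, but the non-edge exponent drops by at least \<open>D * k / 8\<close>, and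
  \<open>tk\<close> makes this saving prevail. The rest cancels against the threshold, whose
  constant leaves \<open>(1 / 16) ^ card R <= (1 / 4) ^ k\<close>, small enough to be summed over
  all \<open>2 ^ k\<close> overlaps.\<close>

lemma overlap_weight_large:
  fixes p b :: real
  assumes p: "0 < p" "p < 1" and b: "b = 1 / (1 - p)" and m: "2 \<le> m" "k \<le> m * t" "m * t < k + t"
    and R: "R \<subseteq> {..<k}" and t: "0 < t" "t\<^sup>2 \<le> k" and large: "k < 2 * card R"
    and n: "16 / p * real t * real k powr (1 / real t) * b powr ((real k - real t + 1) / 2) \<le> real n"
    and tk: "real k ^ (t + 1) \<le> b powr (real k / 8)"
  shows "overlap_weight p m k t n R \<le> real n ^ k * (real k * (1 / 4) ^ k)"
proof -
  let ?r = "card R" and ?R0 = "free_positions m R"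
  define D where "D = k - ?r"
  define B where "B = b powr ((real k - real t + 1) / 2)"
  have b1: "b > 1" using p by (simp add: b)
  have B0: "B > 0" unfolding B_def using b1 by simp
  have finR: "finite R" using R finite_subset by blast
  have rk: "?r \<le> k" using card_mono[OF _ R] by simp
  have k: "k \<ge> 1" using t by (metis One_nat_def Suc_leI le_trans zero_less_power)
  have m0: "m > 0" using m by simp
  have rD: "real ?r = real k - real D" using rk by (simp add: D_def of_nat_diff)
  have n0: "real n > 0"
    by (rule less_le_trans[OF _ n]) (use p b1 t k in auto)

  have 1: "real (k ^ card ?R0 * t ^ card (R - ?R0) * n ^ (k - ?r)) \<le> real k ^ (m + D * t) * real t ^ ?r * real n ^ (k - ?r)"
  proof -
    have "k ^ card ?R0 \<le> k ^ (m + D * t)"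
      using k card_free_positions_le[OF m0 m(2) R] by (intro power_increasing) (auto simp: D_def)
    moreover have "t ^ card (R - ?R0) \<le> t ^ ?r"
      using t finR by (intro power_increasing card_mono) auto
    ultimately have "k ^ card ?R0 * t ^ card (R - ?R0) * n ^ (k - ?r) \<le> k ^ (m + D * t) * t ^ ?r * n ^ (k - ?r)"
      by (intro mult_mono) auto
    then show ?thesis by (metis of_nat_le_iff of_nat_mult of_nat_power)
  qed

  \<comment> \<open>The average block size \<open>k / m\<close> is at least \<open>t - 1\<close>: as
    \<open>t^2 <= k\<close>, rounding \<open>m\<close> up costs at most 1. Hence the exponent of
    \<open>B\<close> has \<open>t - 1\<close> in place of \<open>t\<close>.\<close>
  have "(real t - 1) * real m \<le> real k"
  proof -
    have "(t - 1) * (m * t) \<le> (t - 1) * (k + (t - 1))" using m(3) by (intro mult_left_mono) auto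
    also have "\<dots> \<le> t * k"
    proof (cases t)
      case (Suc u)
      have "u * u \<le> k" using t(2) Suc by (simp add: power2_eq_square)
      then show ?thesis by (simp add: Suc distrib_left)
    qed simp
    finally have "(t - 1) * m * t \<le> k * t" by (simp add: ac_simps)
    then have "(t - 1) * m \<le> k" using t by simp
    then have "real ((t - 1) * m) \<le> real k" by (simp only: of_nat_le_iff)
    then show ?thesis using t by (simp add: of_nat_diff)
  qed
  then have km: "real t - 1 \<le> real k / real m" using m0 by (simp add: field_simps)
  have Dm: "real D / 2 \<le> real D * (1 - 1 / real m)"
  proof -
    have "1 / real m \<le> 1 / 2" using m(1) by (simp add: field_simps)
    then have "real D * (1 / 2) \<le> real D * (1 - 1 / real m)" by (intro mult_left_mono) auto
    then show ?thesis by simp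
  qed
  have "real ?r * (1 - 1 / real m) = real k - real k / real m - real D * (1 - 1 / real m)"
    unfolding rD by (simp add: algebra_simps)
  moreover have "a / 2 \<le> (real k - real t + 1) / 2 - real D / 4"
    if "a = real k - c - d" "real t - 1 \<le> c" "real D / 2 \<le> d" for a c d :: real
    using that by (simp add: field_simps)
  ultimately have e: "real ?r * (1 - 1 / real m) / 2 \<le> (real k - real t + 1) / 2 - real D / 4"
    using km Dm by blast
  have "real ?r * (real ?r * (1 - 1 / real m) / 2) \<le> real ?r * ((real k - real t + 1) / 2 - real D / 4)"
    by (rule mult_left_mono[OF e]) simp
  also have "\<dots> = real ?r * ((real k - real t + 1) / 2) - real D * (real ?r / 4)"
    by (simp add: algebra_simps)
  also have "\<dots> \<le> real ?r * ((real k - real t + 1) / 2) - real D * (real k / 8)"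
    using large by (intro diff_left_mono mult_left_mono) auto
  finally have "1 / (1 - p) ^ card {e \<in> cross_edges m k. e \<subseteq> R}
      \<le> b powr (real ?r * ((real k - real t + 1) / 2) - real D * (real k / 8))"
    using b1 by (intro order_trans[OF inverse_powr_cross_edges_le[OF p b m0 finR]] powr_mono) auto
  also have "\<dots> = B ^ ?r / (b powr (real k / 8)) ^ D"
    using b1 by (simp add: powr_diff B_def powr_power mult.commute)
  finally have 2: "1 / (1 - p) ^ card {e \<in> cross_edges m k. e \<subseteq> R} \<le> B ^ ?r / (b powr (real k / 8)) ^ D" .

  have 3: "real n ^ (k - ?r) \<le> real n ^ k / ((16 / p) ^ ?r * real t ^ ?r * real k powr (real ?r / real t) * B ^ ?r)"
  proof -
    have "(16 / p) ^ ?r * real t ^ ?r * real k powr (real ?r / real t) * B ^ ?r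
      = (16 / p * real t * real k powr (1 / real t) * B) ^ ?r"
      using k by (simp only: power_mult_distrib) (simp add: powr_power)
    also have "\<dots> \<le> real n ^ ?r"
      using n p B0 by (intro power_mono) (auto simp: B_def)
    finally have "(16 / p) ^ ?r * real t ^ ?r * real k powr (real ?r / real t) * B ^ ?r \<le> real n ^ ?r" .
    moreover have "(16 / p) ^ ?r * real t ^ ?r * real k powr (real ?r / real t) * B ^ ?r > 0"
      using p t k B0 by simp
    ultimately have "real n ^ k / real n ^ ?r \<le> real n ^ k / ((16 / p) ^ ?r * real t ^ ?r * real k powr (real ?r / real t) * B ^ ?r)"
      by (intro divide_left_mono mult_pos_pos) (use n0 p t k B0 in auto)
    then show ?thesis using n0 rk by (simp add: power_diff)
  qed

  \<comment> \<open>Since \<open>m <= 1 + k / t\<close> and \<open>k = card R + D\<close>, the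
    centres cost at most \<open>k * k powr (card R / t) * k ^ D\<close>. The middle factor cancels
    against the threshold on \<open>n\<close>, and the last one is why \<open>tk\<close> speaks of
    \<open>t + 1\<close>.\<close>
  have 4: "real k ^ (m + D * t) \<le> real k * (b powr (real k / 8)) ^ D * real k powr (real ?r / real t)"
  proof -
    have "real m * real t \<le> real k + real t"
      using m(3) by (metis less_imp_le of_nat_add of_nat_le_iff of_nat_mult)
    then have "real m \<le> 1 + real k / real t" using t by (simp add: field_simps)
    moreover have "real D / real t \<le> real D" using t by (simp add: field_simps mult_le_cancel_left1)
    ultimately have "real m + real D * real t \<le> (1 + real ((t + 1) * D)) + real ?r / real t"
      unfolding rD by (simp add: diff_divide_distrib algebra_simps)
    then have "real k powr (real m + real D * real t) \<le> real k powr ((1 + real ((t + 1) * D)) + real ?r / real t)"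
      using k by (intro powr_mono) auto
    also have "\<dots> = real k * (real k ^ (t + 1)) ^ D * real k powr (real ?r / real t)"
      using k by (simp only: powr_add powr_realpow power_mult) simp
    also have "\<dots> \<le> real k * (b powr (real k / 8)) ^ D * real k powr (real ?r / real t)"
      by (intro mult_right_mono mult_left_mono power_mono tk) auto
    finally show ?thesis using k by (simp add: powr_realpow[symmetric])
  qed

  have "overlap_weight p m k t n R = real (k ^ card ?R0 * t ^ card (R - ?R0) * n ^ (k - ?r))
     * (1 / (1 - p) ^ card {e \<in> cross_edges m k. e \<subseteq> R}) / p ^ ?r"
    by (simp add: overlap_weight_def mult.commute)
  also have "\<dots> \<le> (real k ^ (m + D * t) * real t ^ ?r * real n ^ (k - ?r)) * (B ^ ?r / (b powr (real k / 8)) ^ D) / p ^ ?r"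
    using p by (intro divide_right_mono mult_mono 1 2) auto
  also have "\<dots> \<le> ((real k * (b powr (real k / 8)) ^ D * real k powr (real ?r / real t)) * real t ^ ?r *
      (real n ^ k / ((16 / p) ^ ?r * real t ^ ?r * real k powr (real ?r / real t) * B ^ ?r))) * (B ^ ?r / (b powr (real k / 8)) ^ D) / p ^ ?r"
    using p B0 by (intro divide_right_mono mult_right_mono mult_mono 3 4) auto
  also have "\<dots> = real n ^ k * (real k * (1 / 16) ^ ?r)"
  proof -
    have "b \<noteq> 0" "B \<noteq> 0" "t \<noteq> 0" "p \<noteq> 0" "k \<noteq> 0" using b1 k B0 t p by auto
    then show ?thesis by (simp add: power_divide field_simps)
  qed
  also have "(1 / 16 :: real) ^ ?r \<le> (1 / 4) ^ k"
  proof -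
    have "(1 / 16 :: real) ^ ?r = (1 / 4) ^ (2 * ?r)" by (simp add: power_mult power2_eq_square)
    also have "\<dots> \<le> (1 / 4) ^ k" using large by (intro power_decreasing) auto
    finally show ?thesis .
  qed
  finally show ?thesis by (simp add: mult_left_mono)
qed

section \<open>Number of embeddings and the resulting bound for small \<open>alpha_t\<close>\<close>

lemma card_embeddings_ge:
  assumes "2 * k\<^sup>2 \<le> n"
  shows "real n ^ k / 2 \<le> real (card (embeddings k n))"
proof (cases "n = 0")
  case True
  then have "k = 0" using assms by simp
  then show ?thesis by (simp add: embeddings_def)
next
  case n: False
  have kn: "k \<le> n" using assms by (metis le_square le_trans mult_2 power2_eq_square trans_le_add1)
  have "card (embeddings k n) = (\<Prod>i = 0..<k. n - i)"
    unfolding embeddings_def using card_inj_on_subset_funcset[of "{..<k}" "{1..n}" "{..<k}"] by simp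
  then have "real (card (embeddings k n)) = (\<Prod>i = 0..<k. real (n - i))" by simp
  also have "\<dots> \<ge> (\<Prod>i = 0..<k. real n * (1 - real k / real n))"
    using kn n by (intro prod_mono) (auto simp: of_nat_diff field_simps)
  finally have "real n ^ k * (1 - real k / real n) ^ k \<le> real (card (embeddings k n))"
    by (simp add: power_mult_distrib)
  moreover have "1 / 2 \<le> (1 - real k / real n) ^ k"
  proof -
    have "2 * (real k)\<^sup>2 \<le> real n" using assms by (metis of_nat_le_iff of_nat_mult of_nat_numeral of_nat_power)
    then have "1 / 2 \<le> 1 + real k * (- (real k / real n))" using n by (simp add: field_simps power2_eq_square)
    also have "\<dots> \<le> (1 + (- (real k / real n))) ^ k"
      using kn n by (intro Bernoulli_inequality) (simp add: field_simps)
    finally show ?thesis by simp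
  qed
  ultimately show ?thesis
    using mult_left_mono[of "1 / 2" "(1 - real k / real n) ^ k" "real n ^ k"] by simp
qed

lemma sum_Pow_power_card:
  fixes v :: "'b :: comm_semiring_1"
  assumes "finite A"
  shows "(\<Sum>X\<in>Pow A. v ^ card X) = (v + 1) ^ card A"
  using prod_add[OF assms, of "\<lambda>_. v" "\<lambda>_. 1"] by simp

text \<open>By the binomial theorem, small overlaps contribute \<open>(1 + v) ^ k - 1\<close>, the
  empty one being removed; the at most \<open>2 ^ k\<close> large ones contribute
  \<open>k * (1 / 4) ^ k\<close> each. The factor 2 comes from having at least
  \<open>n ^ k / 2\<close> embeddings.\<close>

lemma prob_alpha_t_less_le:
  fixes p b :: real
  assumes p: "0 < p" "p < 1" and b: "b = 1 / (1 - p)" and t: "0 < t" "t\<^sup>2 \<le> k" "t < k"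
    and n: "16 / p * real t * real k powr (1 / real t) * b powr ((real k - real t + 1) / 2) \<le> real n"
      "2 * k\<^sup>2 \<le> n"
    and tk: "real k ^ (t + 1) \<le> b powr (real k / 8)"
    and v: "v = real k * b powr (real k / 4) / (real n * p)"
  shows "measure_pmf.prob (Gnp n p) {E. alpha_t t {1..n} E < k} \<le> 2 * ((1 + v) ^ k - 1 + real k * (1 / 2) ^ k)"
proof -
  let ?em = "embeddings k n"
  define m where "m = (k + t - 1) div t"
  define q where "q = p ^ (k - m) * (1 - p) ^ card (cross_edges m k)"
  define \<epsilon> where "\<epsilon> = 2 * ((1 + v) ^ k - 1 + real k * (1 / 2) ^ k)"
  have b1: "b > 1" using p by (simp add: b)
  have k0: "k > 0" using t by simp
  have n0: "n > 0" using n(2) k0 by (cases n) auto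
  have v0: "v \<ge> 0" using p b1 by (simp add: v)
  have mt: "k \<le> m * t" "m * t < k + t"
  proof -
    have "(k + t - 1) mod t < t" using t by simp
    moreover have "m * t + (k + t - 1) mod t = k + t - 1" unfolding m_def by (rule div_mult_mod_eq)
    ultimately show "k \<le> m * t" "m * t < k + t" using t by linarith+
  qed
  have m2: "m \<ge> 2"
  proof (rule ccontr)
    assume "\<not> m \<ge> 2"
    then have "m * t \<le> 1 * t" by (intro mult_right_mono) auto
    then show False using mt t by linarith
  qed
  then have m0: "m > 0" by simp
  have q0: "q > 0" unfolding q_def using p by simp
  have N: "real n ^ k / 2 \<le> real (card ?em)" by (rule card_embeddings_ge[OF n(2)])
  moreover have "real n ^ k / 2 > 0" using n0 by simp
  ultimately have N0: "real (card ?em) > 0" by linarith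
  have "overlap_weight p m k t n R \<le> real n ^ k * v ^ card R + real n ^ k * (real k * (1 / 4) ^ k)"
    if R: "R \<subseteq> {..<k}" for R
  proof (cases "2 * card R \<le> k")
    case True
    then have "overlap_weight p m k t n R \<le> real n ^ k * v ^ card R"
      unfolding v using overlap_weight_small[OF p b m0 R _ n0] t by simp
    then show ?thesis by (simp add: add_increasing2)
  next
    case False
    then have "overlap_weight p m k t n R \<le> real n ^ k * (real k * (1 / 4) ^ k)"
      by (intro overlap_weight_large[OF p b m2 mt R t(1,2) _ n(1) tk]) simp
    moreover have "0 \<le> real n ^ k * v ^ card R" using v0 by simp
    ultimately show ?thesis by linarith
  qed
  then have "(\<Sum>R\<in>Pow {..<k} - {{}}. overlap_weight p m k t n R)
      \<le> (\<Sum>R\<in>Pow {..<k} - {{}}. real n ^ k * v ^ card R + real n ^ k * (real k * (1 / 4) ^ k))"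
    by (intro sum_mono) auto
  also have "\<dots> = real n ^ k * (\<Sum>R\<in>Pow {..<k} - {{}}. v ^ card R)
      + real (card (Pow {..<k} - {{}})) * (real n ^ k * (real k * (1 / 4) ^ k))"
    by (simp add: sum.distrib sum_distrib_left)
  also have "(\<Sum>R\<in>Pow {..<k} - {{}}. v ^ card R) = (1 + v) ^ k - 1"
    using sum_Pow_power_card[of "{..<k}" v] by (simp add: sum_diff1 add.commute)
  also have "real (card (Pow {..<k} - {{}})) * (real n ^ k * (real k * (1 / 4) ^ k))
      \<le> 2 ^ k * (real n ^ k * (real k * (1 / 4) ^ k))"
  proof (rule mult_right_mono)
    have "card (Pow {..<k} - {{}}) \<le> card (Pow {..<k})" by (rule card_mono) auto
    also have "\<dots> = 2 ^ k" by (simp add: card_Pow)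
    finally show "real (card (Pow {..<k} - {{}})) \<le> 2 ^ k"
      by (metis of_nat_le_iff of_nat_numeral of_nat_power)
  qed simp
  also have "2 ^ k * (real n ^ k * (real k * (1 / 4) ^ k)) = real n ^ k * (real k * (1 / 2) ^ k)"
  proof -
    have "(2::real) ^ k * (1 / 4) ^ k = (1 / 2) ^ k" by (simp add: power_mult_distrib[symmetric])
    then show ?thesis by (simp add: mult.left_commute)
  qed
  also have "real n ^ k * ((1 + v) ^ k - 1) + real n ^ k * (real k * (1 / 2) ^ k) = (real n ^ k / 2) * \<epsilon>"
    by (simp add: \<epsilon>_def algebra_simps)
  also have "\<dots> \<le> real (card ?em) * \<epsilon>"
  proof (rule mult_right_mono[OF N])
    have "(1 + v) ^ k \<ge> 1" using v0 by (intro one_le_power) simp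
    then show "\<epsilon> \<ge> 0" by (simp add: \<epsilon>_def)
  qed
  finally have W: "(\<Sum>R\<in>Pow {..<k} - {{}}. overlap_weight p m k t n R) \<le> real (card ?em) * \<epsilon>"
    by simp
  have "measure_pmf.prob (Gnp n p) {E. \<forall>x\<in>?em. E \<notin> star_event m k x} \<le> \<epsilon>"
  proof (rule prob_no_event_le[OF finite_embeddings _ q0])
    show "?em \<noteq> {}" using N0 by auto
    fix x assume x: "x \<in> ?em"
    show "measure_pmf.prob (Gnp n p) (star_event m k x) = q"
      unfolding q_def by (rule prob_star_event[OF p m0 x])
    have "(\<Sum>y\<in>?em. measure_pmf.prob (Gnp n p) (star_event m k x \<inter> star_event m k y))
      \<le> q\<^sup>2 * (real (card ?em) + (\<Sum>R\<in>Pow {..<k} - {{}}. overlap_weight p m k t n R))"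
      by (rule sum_two_star_events_le[OF p m0 mt(1) x q_def])
    also have "\<dots> \<le> q\<^sup>2 * (real (card ?em) + real (card ?em) * \<epsilon>)"
      by (intro mult_left_mono add_left_mono W) simp
    finally show "(\<Sum>y\<in>?em. measure_pmf.prob (Gnp n p) (star_event m k x \<inter> star_event m k y))
      \<le> (1 + \<epsilon>) * (real (card ?em) * q\<^sup>2)"
      by (simp add: algebra_simps)
  qed
  moreover have "measure_pmf.prob (Gnp n p) {E. alpha_t t {1..n} E < k}
      \<le> measure_pmf.prob (Gnp n p) {E. \<forall>x\<in>?em. E \<notin> star_event m k x}"
    using star_event_alpha_t[OF m0 mt(1)] by (intro measure_pmf.finite_measure_mono) fastforce+
  ultimately show ?thesis unfolding \<epsilon>_def by linarith
qed

subsection \<open>Asymptotics\<close>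

definition alpha_t_estimate :: "real \<Rightarrow> real \<Rightarrow> nat \<Rightarrow> nat \<Rightarrow> real" where
  "alpha_t_estimate p b n t = 2 * log b (real n) + real t - 2 * log b (real t)
     - 2 * log b (log b (real n * p)) / real t"

text \<open>The estimate is the \<open>T\<close> that solves
  \<open>n * b powr ((t - T) / 2) = t * l powr (1 / t)\<close> with
  \<open>l = log b (n * p)\<close>. Both tail bounds have \<open>k\<close> in place of
  \<open>l\<close>, which is harmless: the upper tail uses that its \<open>K\<close> is at least
  \<open>l\<close>, the lower tail that its \<open>k\<close> is at most
  \<open>3 * l\<close>.\<close>

lemma powr_half_estimate:
  fixes p b :: real
  assumes b: "1 < b" and n: "0 < n" and t: "0 < t" and l: "0 < log b (real n * p)"
  shows "b powr ((alpha_t_estimate p b n t - real t) / 2)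
    = real n / (real t * log b (real n * p) powr (1 / real t))"
proof -
  let ?l = "log b (real n * p)"
  have "(alpha_t_estimate p b n t - real t) / 2 = log b (real n) - (log b (real t) + log b ?l * (1 / real t))"
    by (simp add: alpha_t_estimate_def diff_divide_distrib)
  then have "b powr ((alpha_t_estimate p b n t - real t) / 2)
      = b powr log b (real n) / (b powr log b (real t) * (b powr log b ?l) powr (1 / real t))"
    by (simp only: powr_diff powr_add powr_powr)
  then show ?thesis using b n t l by simp
qed

text \<open>The shift \<open>2 * log b (8 * exp 2)\<close> divides the per-vertex factor by
  \<open>8 * exp 2\<close>, which brings the base of the first moment bound down to
  \<open>1 / 2\<close>.\<close>

lemma prob_alpha_t_upper_tail:
  fixes p b :: real
  assumes p: "0 < p" "p < 1" and b: "b = 1 / (1 - p)" and n: "0 < n" and t: "0 < t"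
    and et: "exp (real t) \<le> log b (real n)" and l: "1 \<le> log b (real n * p)"
    and T: "log b (real n) \<le> alpha_t_estimate p b n t"
  shows "measure_pmf.prob (Gnp n p)
    {E. alpha_t_estimate p b n t + 2 * log b (8 * exp 2) < real (alpha_t t {1..n} E)}
    \<le> (1 / 2) powr log b (real n)"
proof -
  let ?l = "log b (real n * p)" and ?L = "log b (real n)"
  define T where "T = alpha_t_estimate p b n t"
  define K where "K = nat \<lceil>T + 2 * log b (8 * exp 2)\<rceil>"
  have b1: "b > 1" using p by (simp add: b)
  have "(8::real) * exp 2 \<ge> 1" using one_le_exp_iff[of 2] by (simp del: one_le_exp_iff)
  then have C0: "log b (8 * exp 2) \<ge> 0" using b1 by simp
  have KT: "T + 2 * log b (8 * exp 2) \<le> real K" unfolding K_def by (rule real_nat_ceiling_ge)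
  then have KL: "?L \<le> real K" using C0 T by (simp add: T_def)
  have L0: "?L > 0" using et exp_gt_zero[of "real t"] by linarith
  have lL: "?l \<le> ?L" using p n b1 by (simp add: log_le_cancel_iff mult_le_cancel_left1)
  have lK: "?l \<le> real K" using lL KL by simp
  have K0: "real K > 0" using KL L0 by simp
  have "b powr ((real t - real K) / 2) \<le> b powr (- ((T - real t) / 2) - log b (8 * exp 2))"
    using b1 KT by (intro powr_mono) (auto simp: field_simps)
  also have "\<dots> = real t * ?l powr (1 / real t) / real n / (8 * exp 2)"
    using powr_half_estimate[OF b1 n t, of p] l b1
    by (simp add: powr_diff powr_minus T_def)
  finally have "4 * exp 2 * real n * b powr ((real t - real K) / 2) / (real K powr (1 / real t) * real t)
     \<le> 4 * exp 2 * real n * (real t * ?l powr (1 / real t) / real n / (8 * exp 2)) / (real K powr (1 / real t) * real t)"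
    by (intro divide_right_mono mult_left_mono) auto
  also have "\<dots> = ?l powr (1 / real t) / real K powr (1 / real t) / 2"
    using n t by (simp add: field_simps)
  also have "\<dots> \<le> 1 / 2"
  proof -
    have "?l powr (1 / real t) \<le> real K powr (1 / real t)"
      using lK l by (intro powr_mono2) auto
    then show ?thesis using K0 by (simp add: divide_le_eq)
  qed
  finally have base: "4 * exp 2 * real n * b powr ((real t - real K) / 2) / (real K powr (1 / real t) * real t) \<le> 1 / 2" .
  have "measure_pmf.prob (Gnp n p) {E. T + 2 * log b (8 * exp 2) < real (alpha_t t {1..n} E)}
      \<le> measure_pmf.prob (Gnp n p) {E. K \<le> alpha_t t {1..n} E}"
    unfolding K_def by (intro measure_pmf.finite_measure_mono) (auto simp: nat_ceiling_le_eq)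
  also have "\<dots> \<le> (4 * exp 2 * real n * b powr ((real t - real K) / 2) / (real K powr (1 / real t) * real t)) ^ K"
    using t et KL by (intro prob_alpha_t_ge_le[OF p b]) auto
  also have "\<dots> \<le> (1 / 2) ^ K"
    by (rule power_mono[OF base]) simp
  also have "\<dots> = (1 / 2) powr real K" by (simp add: powr_realpow)
  also have "\<dots> \<le> (1 / 2) powr ?L" using KL by (intro powr_mono') auto
  finally show ?thesis unfolding T_def .
qed

text \<open>In \<open>C\<close>, the 1 compensates the \<open>+ 1\<close> in the exponent
  \<open>(k - t + 1) / 2\<close>, and \<open>48 / p\<close> is the constant \<open>16 / p\<close> of
  the threshold times the 3 from \<open>k <= 3 * l\<close>. The further 1 in the conclusion pays for
  rounding \<open>k\<close> down. The hypotheses \<open>cond\<close> and the final bound are free of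
  \<open>t\<close>, which makes the result uniform in \<open>t\<close>.\<close>

lemma prob_alpha_t_lower_tail:
  fixes p b :: real
  assumes p: "0 < p" "p < 1" and b: "b = 1 / (1 - p)" and n: "0 < n" and t: "0 < t"
    and L: "L = log b (real n)" and C: "C = 1 + 2 * log b (48 / p)"
    and tL: "real t \<le> ln L" and L1: "1 < L" and l: "1 \<le> log b (real n * p)"
    and T_ge: "L + 1 + C \<le> alpha_t_estimate p b n t" and T_le: "alpha_t_estimate p b n t \<le> 2 * L + ln L"
    and cond: "2 * L + ln L \<le> 3 * log b (real n * p)" "(ln L)\<^sup>2 \<le> L" "ln L < L"
      "2 * (3 * L)\<^sup>2 \<le> real n" "(ln L + 1) * ln (3 * L) \<le> L / 8 * ln b"
  shows "measure_pmf.prob (Gnp n p)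
    {E. real (alpha_t t {1..n} E) < alpha_t_estimate p b n t - (C + 1)}
    \<le> 2 * (exp (9 * L\<^sup>2 * exp (((2 * L + ln L) / 4 - L) * ln b) / p) - 1 + 3 * L * (1 / 2) powr L)"
proof -
  let ?l = "log b (real n * p)"
  define T where "T = alpha_t_estimate p b n t"
  define k where "k = nat \<lfloor>T - C\<rfloor>"
  define v where "v = real k * b powr (real k / 4) / (real n * p)"
  have b1: "b > 1" using p by (simp add: b)
  have "48 / p \<ge> 1" using p by (simp add: field_simps)
  then have "log b (48 / p) \<ge> 0" using b1 p by (subst zero_le_log_cancel_iff) auto
  then have C0: "C > 0" by (simp add: C)
  have TC: "T - C \<ge> L + 1" using T_ge by (simp add: T_def)
  then have k_le: "real k \<le> T - C" unfolding k_def using L1 by (simp add: of_nat_nat)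
  have k_gt: "T - C - 1 < real k" unfolding k_def using TC L1 by linarith
  have kL: "L \<le> real k" using k_gt TC by simp
  have k2: "real k \<le> 2 * L + ln L" using k_le T_le C0 by (simp add: T_def)
  have k3: "real k \<le> 3 * L" using k2 cond(3) by simp
  have k3l: "real k \<le> 3 * ?l" using k2 cond(1) by simp
  have k1: "real k > 1" using kL L1 by simp
  have nL: "real n = exp (L * ln b)" using n b1 by (simp add: L log_def)

  have "16 / p * real t * real k powr (1 / real t) * b powr ((real k - real t + 1) / 2)
     \<le> 16 / p * real t * (3 * ?l powr (1 / real t)) * (real n / (real t * ?l powr (1 / real t)) * (p / 48))"
  proof (intro mult_mono)
    have "real k powr (1 / real t) \<le> (3 * ?l) powr (1 / real t)"
      using k3l by (intro powr_mono2) auto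
    also have "\<dots> = 3 powr (1 / real t) * ?l powr (1 / real t)" using l by (simp add: powr_mult)
    also have "\<dots> \<le> 3 * ?l powr (1 / real t)"
      using powr_mono[of "1 / real t" 1 3] t by (intro mult_right_mono) auto
    finally show "real k powr (1 / real t) \<le> 3 * ?l powr (1 / real t)" .
    have "b powr ((real k - real t + 1) / 2) \<le> b powr ((T - real t) / 2 - log b (48 / p))"
      using b1 k_le by (intro powr_mono) (auto simp: C field_simps)
    also have "\<dots> = real n / (real t * ?l powr (1 / real t)) * (p / 48)"
      using powr_half_estimate[OF b1 n t, of p] l b1 p by (simp add: powr_diff T_def)
    finally show "b powr ((real k - real t + 1) / 2) \<le> real n / (real t * ?l powr (1 / real t)) * (p / 48)" .
  qed (use p l in auto)
  also have "\<dots> = real n" using p t l by (simp add: field_simps)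
  finally have n1: "16 / p * real t * real k powr (1 / real t) * b powr ((real k - real t + 1) / 2) \<le> real n" .

  have "real (t\<^sup>2) \<le> real k"
    using power_mono[OF tL, of 2] cond(2) kL by (simp only: of_nat_power) linarith
  then have t2: "t\<^sup>2 \<le> k" by (simp only: of_nat_le_iff)
  have tk: "t < k" using tL cond(3) kL by linarith
  have "2 * (real k)\<^sup>2 \<le> 2 * (3 * L)\<^sup>2" using k3 by (intro mult_left_mono power_mono) auto
  then have "real (2 * k\<^sup>2) \<le> real n" using cond(4) by simp
  then have n2: "2 * k\<^sup>2 \<le> n" by (simp only: of_nat_le_iff)

  have "real k ^ (t + 1) = exp ((real t + 1) * ln (real k))"
    using k1 by (subst powr_realpow[symmetric]) (auto simp: powr_def add.commute)
  also have "\<dots> \<le> exp ((ln L + 1) * ln (3 * L))"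
    using tL k3 k1 L1 by (intro iffD2[OF exp_le_cancel_iff] mult_mono) auto
  also have "\<dots> \<le> exp (real k / 8 * ln b)"
  proof -
    have "L / 8 * ln b \<le> real k / 8 * ln b" using kL b1 by (intro mult_right_mono) auto
    with cond(5) show ?thesis by simp
  qed
  also have "\<dots> = b powr (real k / 8)" using b1 by (simp add: powr_def)
  finally have kt: "real k ^ (t + 1) \<le> b powr (real k / 8)" .

  have v0: "v \<ge> 0" using p by (simp add: v_def)
  \<comment> \<open>The exponent obtained is \<open>(- L / 2 + ln L / 4) * ln b\<close>, so
    \<open>k * v\<close> is at most \<open>1 / sqrt n\<close> times a power of \<open>log n\<close>,
    up to a constant.\<close>
  have "real k * v = (real k)\<^sup>2 * exp (real k / 4 * ln b) / (exp (L * ln b) * p)"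
    using b1 by (simp add: v_def powr_def nL power2_eq_square)
  also have "\<dots> \<le> (3 * L)\<^sup>2 * exp ((2 * L + ln L) / 4 * ln b) / (exp (L * ln b) * p)"
    using k2 k3 p b1 by (intro divide_right_mono mult_mono power_mono) auto
  also have "\<dots> = 9 * L\<^sup>2 * exp (((2 * L + ln L) / 4 - L) * ln b) / p"
    by (simp add: left_diff_distrib exp_diff power_mult_distrib)
  finally have kv: "real k * v \<le> 9 * L\<^sup>2 * exp (((2 * L + ln L) / 4 - L) * ln b) / p" .
  have "(1 + v) ^ k \<le> exp v ^ k" using v0 by (intro power_mono) (auto simp: exp_ge_add_one_self)
  also have "\<dots> = exp (real k * v)" by (simp add: exp_of_nat_mult)
  also have "\<dots> \<le> exp (9 * L\<^sup>2 * exp (((2 * L + ln L) / 4 - L) * ln b) / p)" using kv by simp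
  finally have e1: "(1 + v) ^ k \<le> exp (9 * L\<^sup>2 * exp (((2 * L + ln L) / 4 - L) * ln b) / p)" .
  have "(1 / 2 :: real) ^ k = (1 / 2) powr real k" by (simp add: powr_realpow)
  also have "\<dots> \<le> (1 / 2) powr L" using kL by (intro powr_mono') auto
  finally have e2: "real k * (1 / 2) ^ k \<le> 3 * L * (1 / 2) powr L"
    using k3 by (intro mult_mono) auto

  have "measure_pmf.prob (Gnp n p) {E. real (alpha_t t {1..n} E) < T - (C + 1)}
      \<le> measure_pmf.prob (Gnp n p) {E. alpha_t t {1..n} E < k}"
    using k_gt by (intro measure_pmf.finite_measure_mono) auto
  also have "\<dots> \<le> 2 * ((1 + v) ^ k - 1 + real k * (1 / 2) ^ k)"
    by (rule prob_alpha_t_less_le[OF p b t t2 tk n1 n2 kt v_def])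
  also have "\<dots> \<le> 2 * (exp (9 * L\<^sup>2 * exp (((2 * L + ln L) / 4 - L) * ln b) / p) - 1 + 3 * L * (1 / 2) powr L)"
    by (intro mult_left_mono add_mono diff_right_mono e1 e2) simp
  finally show ?thesis unfolding T_def .
qed

theorem theorem1p3:
  fixes p b :: real and t :: "nat \<Rightarrow> nat"
  assumes "0 < p" and "p < 1" and "b = 1 / (1 - p)"
    and "\<forall>n. 0 < t n"
    and "\<forall>\<^sub>F n in sequentially. real (t n) \<le> ln (log b (real n))"
  shows "\<exists>C :: real.
    (\<lambda>n. measure_pmf.prob (Gnp n p)
       {E. \<bar>real (alpha_t (t n) {1..n} E) -
             (2 * log b (real n) + real (t n) - 2 * log b (real (t n))
              - 2 * log b (log b (real n * p)) / real (t n))\<bar> \<le> C})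
    \<longlonglongrightarrow> 1"
proof -
  note p = assms(1,2) and b = assms(3)
  define \<beta> where "\<beta> = ln b"
  define c where "c = log b p"
  define C where "C = 1 + 2 * log b (48 / p)"
  define C' where "C' = max (2 * log b (8 * exp 2)) (C + 1)"
  define T where "T n = alpha_t_estimate p b n (t n)" for n
  define good where "good n = {E. \<bar>real (alpha_t (t n) {1..n} E) - T n\<bar> \<le> C'}" for n
  \<comment> \<open>The sum of both tail bounds as a function of \<open>x = log b n\<close> alone,
    so that its limit does not involve the sequence \<open>t\<close>.\<close>
  define err where "err x = (1 / 2) powr x
    + 2 * (exp (9 * x\<^sup>2 * exp (((2 * x + ln x) / 4 - x) * \<beta>) / p) - 1 + 3 * x * (1 / 2) powr x)" for x :: real
  let ?P = "\<lambda>n. measure_pmf.prob (Gnp n p)"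
  have b1: "b > 1" using p by (simp add: b)
  then have \<beta>: "\<beta> > 0" by (simp add: \<beta>_def)
  have L_lim: "filterlim (\<lambda>n. log b (real n)) at_top sequentially"
    unfolding log_def using \<beta>[unfolded \<beta>_def] by real_asymp
  have "(err \<longlongrightarrow> 0 + 2 * (exp 0 - 1 + 0)) at_top"
    unfolding err_def using \<beta> p by (intro tendsto_add tendsto_mult tendsto_diff tendsto_exp tendsto_const) real_asymp+
  then have "(err \<longlongrightarrow> 0) at_top" by simp
  from filterlim_compose[OF this L_lim] have err_lim: "(\<lambda>n. err (log b (real n))) \<longlonglongrightarrow> 0" .

  \<comment> \<open>Every largeness condition is stated in \<open>x = log b n\<close>, with
    \<open>x + c\<close> for \<open>log b (n * p)\<close> and \<open>exp (x * \<beta>)\<close> for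
    \<open>n\<close>. The sequence \<open>t\<close> is eliminated by its extreme values:
    \<open>2 * log b t\<close> is at most \<open>2 * ln (ln x) / \<beta>\<close>, and the last term
    of the estimate is largest for \<open>t = 1\<close>.\<close>
  have "\<forall>\<^sub>F x :: real in at_top. 1 < x \<and> 0 < ln x \<and> 1 \<le> x + c \<and> 2 * x + ln x \<le> 3 * (x + c)
     \<and> x + 1 + C \<le> 2 * x - 2 * (ln (ln x) / \<beta>) - 2 * (ln x / \<beta>) \<and> (ln x)\<^sup>2 \<le> x \<and> ln x < x
     \<and> 2 * (3 * x)\<^sup>2 \<le> exp (x * \<beta>) \<and> (ln x + 1) * ln (3 * x) \<le> x / 8 * \<beta>"
    using \<beta> by (intro eventually_conj) real_asymp+
  note ev = filterlim_iff[THEN iffD1, OF L_lim, rule_format, OF this]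

  have lower: "\<forall>\<^sub>F n in sequentially. 1 - err (log b (real n)) \<le> ?P n (good n)"
    using ev assms(5) eventually_gt_at_top[of 0]
  proof eventually_elim
    case (elim n)
    let ?L = "log b (real n)"
    have t: "0 < t n" using assms(4) by simp
    have tL: "real (t n) \<le> ln ?L" and n: "0 < n" using elim by auto
    have L: "1 < ?L" "0 < ln ?L" "1 \<le> ?L + c" "2 * ?L + ln ?L \<le> 3 * (?L + c)"
      "?L + 1 + C \<le> 2 * ?L - 2 * (ln (ln ?L) / \<beta>) - 2 * (ln ?L / \<beta>)" "(ln ?L)\<^sup>2 \<le> ?L" "ln ?L < ?L"
      "2 * (3 * ?L)\<^sup>2 \<le> exp (?L * \<beta>)" "(ln ?L + 1) * ln (3 * ?L) \<le> ?L / 8 * \<beta>"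
      using elim(1) by auto
    have l: "log b (real n * p) = ?L + c" using n p b1 by (simp add: log_mult c_def)
    have l1: "1 \<le> log b (real n * p)" using L(3) by (simp add: l)
    have c: "c \<le> 0" using p b1 by (simp add: c_def)
    have n_exp: "exp (?L * \<beta>) = real n" using n b1 by (simp add: log_def \<beta>_def)
    have lt: "0 \<le> log b (real (t n))" "log b (real (t n)) \<le> ln (ln ?L) / \<beta>"
    proof -
      show "0 \<le> log b (real (t n))" using t b1 by simp
      have "ln (real (t n)) \<le> ln (ln ?L)" using tL t L(2) by simp
      then show "log b (real (t n)) \<le> ln (ln ?L) / \<beta>"
        unfolding log_def \<beta>_def[symmetric] using \<beta> by (intro divide_right_mono) auto
    qed
    have ll: "0 \<le> log b (?L + c)" "log b (?L + c) \<le> ln ?L / \<beta>"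
    proof -
      show "0 \<le> log b (?L + c)" using L(3) b1 by simp
      have "ln (?L + c) \<le> ln ?L" using c L(1,3) by simp
      then show "log b (?L + c) \<le> ln ?L / \<beta>"
        unfolding log_def[of b "?L + c"] \<beta>_def[symmetric] using \<beta> by (intro divide_right_mono) auto
    qed
    have llt: "0 \<le> log b (?L + c) / real (t n)" "log b (?L + c) / real (t n) \<le> log b (?L + c)"
      using ll(1) t by (auto simp: divide_le_eq mult_le_cancel_left1)
    have T_eq: "T n = 2 * ?L + real (t n) - 2 * log b (real (t n)) - 2 * (log b (?L + c) / real (t n))"
      by (simp add: T_def alpha_t_estimate_def l)
    have T_le: "T n \<le> 2 * ?L + ln ?L" unfolding T_eq using lt(1) llt(1) tL by linarith
    have T_ge: "?L + 1 + C \<le> T n" unfolding T_eq using lt(2) llt(2) ll(2) L(5) by linarith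
    have "48 / p \<ge> 1" using p by (simp add: field_simps)
    then have "log b (48 / p) \<ge> 0" using b1 p by (subst zero_le_log_cancel_iff) auto
    then have "C \<ge> 0" by (simp add: C_def)
    then have T_ge': "?L \<le> T n" using T_ge by linarith
    have et: "exp (real (t n)) \<le> ?L" using tL L(1) by (simp add: ln_ge_iff)
    let ?U = "{E. T n + 2 * log b (8 * exp 2) < real (alpha_t (t n) {1..n} E)}"
    let ?W = "{E. real (alpha_t (t n) {1..n} E) < T n - (C + 1)}"
    have "?P n ?U \<le> (1 / 2) powr ?L"
      unfolding T_def using T_ge' by (intro prob_alpha_t_upper_tail[OF p b n t et l1]) (simp add: T_def)
    moreover have "?P n ?W
      \<le> 2 * (exp (9 * ?L\<^sup>2 * exp (((2 * ?L + ln ?L) / 4 - ?L) * ln b) / p) - 1 + 3 * ?L * (1 / 2) powr ?L)"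
      unfolding T_def
      by (rule prob_alpha_t_lower_tail[OF p b n t refl C_def tL L(1) l1 T_ge[unfolded T_def] T_le[unfolded T_def]
            L(4)[folded l] L(6,7) L(8)[unfolded n_exp] L(9)[unfolded \<beta>_def]])
    ultimately have "?P n ?U + ?P n ?W \<le> err ?L" by (simp add: err_def \<beta>_def)
    moreover have "1 = ?P n UNIV" by simp
    moreover have "?P n UNIV \<le> ?P n (good n \<union> (?U \<union> ?W))"
      by (rule measure_pmf.finite_measure_mono) (auto simp: good_def C'_def)
    moreover have "?P n (good n \<union> (?U \<union> ?W)) \<le> ?P n (good n) + ?P n (?U \<union> ?W)"
      by (rule measure_Un_le) auto
    moreover have "?P n (?U \<union> ?W) \<le> ?P n ?U + ?P n ?W"
      by (rule measure_Un_le) auto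
    ultimately show ?case by linarith
  qed
  have lim: "(\<lambda>n. 1 - err (log b (real n))) \<longlonglongrightarrow> 1"
    using tendsto_diff[OF tendsto_const err_lim, of 1] by simp
  have upper: "\<forall>\<^sub>F n in sequentially. ?P n (good n) \<le> 1" by simp
  have "(\<lambda>n. ?P n (good n)) \<longlonglongrightarrow> 1"
    by (rule tendsto_sandwich[OF lower upper lim tendsto_const])
  then show ?thesis unfolding good_def T_def alpha_t_estimate_def by (rule exI)
qed

end
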